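(* Let $P$ be a finite pure poset. Then $C_P$ is a normal affine semigroup. Consequently, $\mathbb{K}[C_P]$ is a normal domain.
   Context: $\mathbb{N}_0=\{0,1,2,\dots\}$ and $\mathbb{K}$ is a field. The length of a chain $C$ in a finite poset is $|C|-1$. A finite poset $P$ is pure of rank $r$ if every maximal chain of $P$ has length $r$. Let $R=\mathbb{K}[x : x\in P]$ be the polynomial ring with variables the elements of $P$. To each maximal chain $C: x_0<x_1<\cdots<x_r$ associate the monomial $x_C=x_0x_1\cdots x_r\in R$. The chain algebra $\mathbb{K}[C_P]$ is the $\mathbb{K}$-subalgebra of $R$ generated by all $x_C$, with $C$ a maximal chain of $P$. The chain semigroup $C_P\subseteq\mathbb{N}_0^P$ is the set of all functions $f:P\to\mathbb{N}_0$ such that $\prod_{x\in P}x^{f(x)}\in\mathbb{K}[C_P]$, under pointwise addition. An affine semigroup is a finitely generated sub-semigroup of $\mathbb{Z}^d$ (for some $d>0$) containing $\mathbf{0}$. An affine semigroup $S\subseteq\mathbb{N}_0^d$ is normal if for all $\alpha,\beta,\gamma\in S$ and integers $n>0$ with $n\alpha=n\beta+\gamma$ there is $\gamma'\in S$ with $\gamma=n\gamma'$. A domain is normal if it is integrally closed in its field of fractions. *)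

theory Defs
  imports
    "HOL-Library.Poly_Mapping"
    "HOL-Algebra.Generated_Rings"
begin

section \<open>Chains in a finite poset\<close>

text \<open>A poset is a set \<open>P\<close> with a relation \<open>r\<close> such that \<^term>\<open>partial_order_on P r\<close>; in
  particular \<open>r \<subseteq> P \<times> P\<close>, so every member of \<^term>\<open>Chains r\<close> is a subset of \<open>P\<close>.\<close>

definition maximal_chains :: "'a rel \<Rightarrow> 'a set set" where
  "maximal_chains r = {C \<in> Chains r. \<forall>D \<in> Chains r. C \<subseteq> D \<longrightarrow> D = C}"

text \<open>Lengths are integers because the empty chain has length \<open>-1\<close>; it is maximal precisely in
  the empty poset.\<close>

definition chain_length :: "'a set \<Rightarrow> int" where
  "chain_length C = int (card C) - 1"

definition pure_of_rank :: "'a rel \<Rightarrow> int \<Rightarrow> bool" where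
  "pure_of_rank r \<rho> \<longleftrightarrow> (\<forall>C \<in> maximal_chains r. chain_length C = \<rho>)"

definition pure_poset :: "'a rel \<Rightarrow> bool" where
  "pure_poset r \<longleftrightarrow> (\<exists>\<rho>. pure_of_rank r \<rho>)"


section \<open>Normal affine semigroups\<close>

text \<open>\<open>\<int>\<^sup>d\<close> is rendered as the group of functions \<open>I \<rightarrow> \<int>\<close> for a finite nonempty index set \<open>I\<close> with
  \<open>d\<close> elements, realised inside \<^typ>\<open>'i \<Rightarrow>\<^sub>0 int\<close> as the functions supported in \<open>I\<close>. Integer
  multiples are written with \<^const>\<open>frag_cmul\<close>.\<close>

definition add_closed :: "'b::plus set \<Rightarrow> bool" where
  "add_closed S \<longleftrightarrow> (\<forall>a \<in> S. \<forall>b \<in> S. a + b \<in> S)"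

definition affine_semigroup :: "('i \<Rightarrow>\<^sub>0 int) set \<Rightarrow> bool" where
  "affine_semigroup S \<longleftrightarrow>
     (\<exists>I. finite I \<and> I \<noteq> {} \<and> (\<forall>\<alpha> \<in> S. Poly_Mapping.keys \<alpha> \<subseteq> I)) \<and>
     (\<exists>G. finite G \<and> S = add_closed hull G) \<and> 0 \<in> S"

definition normal_affine_semigroup :: "('i \<Rightarrow>\<^sub>0 int) set \<Rightarrow> bool" where
  "normal_affine_semigroup S \<longleftrightarrow>
     affine_semigroup S \<and>
     (\<forall>\<alpha> \<in> S. \<forall>i. 0 \<le> Poly_Mapping.lookup \<alpha> i) \<and>
     (\<forall>\<alpha> \<in> S. \<forall>\<beta> \<in> S. \<forall>\<gamma> \<in> S. \<forall>n::int. n > 0 \<longrightarrow>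
        frag_cmul n \<alpha> = frag_cmul n \<beta> + \<gamma> \<longrightarrow> (\<exists>\<gamma>' \<in> S. \<gamma> = frag_cmul n \<gamma>'))"


section \<open>Normal domains\<close>

text \<open>The field of fractions of a domain, as the set of classes \<open>a/b\<close> of pairs \<open>(a, b)\<close>.\<close>

definition frac_rel :: "('r, 'm) ring_scheme \<Rightarrow> ('r \<times> 'r) rel" where
  "frac_rel R = {((a, b), (c, d)). a \<in> carrier R \<and> b \<in> carrier R - {\<zero>\<^bsub>R\<^esub>} \<and>
     c \<in> carrier R \<and> d \<in> carrier R - {\<zero>\<^bsub>R\<^esub>} \<and> a \<otimes>\<^bsub>R\<^esub> d = c \<otimes>\<^bsub>R\<^esub> b}"

definition fraction :: "('r, 'm) ring_scheme \<Rightarrow> 'r \<Rightarrow> 'r \<Rightarrow> ('r \<times> 'r) set" where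
  "fraction R a b = frac_rel R `` {(a, b)}"

definition frac_field :: "('r, 'm) ring_scheme \<Rightarrow> ('r \<times> 'r) set ring" where
  "frac_field R =
     \<lparr>carrier = (carrier R \<times> (carrier R - {\<zero>\<^bsub>R\<^esub>})) // frac_rel R,
      mult = (\<lambda>X Y. \<Union>(a, b) \<in> X. \<Union>(c, d) \<in> Y. fraction R (a \<otimes>\<^bsub>R\<^esub> c) (b \<otimes>\<^bsub>R\<^esub> d)),
      one = fraction R \<one>\<^bsub>R\<^esub> \<one>\<^bsub>R\<^esub>,
      zero = fraction R \<zero>\<^bsub>R\<^esub> \<one>\<^bsub>R\<^esub>,
      add = (\<lambda>X Y. \<Union>(a, b) \<in> X. \<Union>(c, d) \<in> Y.
               fraction R (a \<otimes>\<^bsub>R\<^esub> d \<oplus>\<^bsub>R\<^esub> c \<otimes>\<^bsub>R\<^esub> b) (b \<otimes>\<^bsub>R\<^esub> d))\<rparr>"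

definition frac_embed :: "('r, 'm) ring_scheme \<Rightarrow> 'r \<Rightarrow> ('r \<times> 'r) set" where
  "frac_embed R a = fraction R a \<one>\<^bsub>R\<^esub>"

definition integral_over :: "('r, 'm) ring_scheme \<Rightarrow> 'r set \<Rightarrow> 'r \<Rightarrow> bool" where
  "integral_over F A x \<longleftrightarrow>
     (\<exists>n::nat. \<exists>c \<in> {..<n} \<rightarrow> A.
        x [^]\<^bsub>F\<^esub> n \<oplus>\<^bsub>F\<^esub> (\<Oplus>\<^bsub>F\<^esub>i \<in> {..<n}. c i \<otimes>\<^bsub>F\<^esub> x [^]\<^bsub>F\<^esub> i) = \<zero>\<^bsub>F\<^esub>)"

definition normal_domain :: "('r, 'm) ring_scheme \<Rightarrow> bool" where
  "normal_domain R \<longleftrightarrow> domain R \<and>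
     (\<forall>x \<in> carrier (frac_field R).
        integral_over (frac_field R) (frac_embed R ` carrier R) x \<longrightarrow>
        x \<in> frac_embed R ` carrier R)"


subsection \<open>The fraction field is a field containing the domain\<close>

context domain
begin

lemma equiv_frac_rel: "equiv (carrier R \<times> (carrier R - {\<zero>})) (frac_rel R)"
proof (rule equivI)
  show "frac_rel R \<subseteq> (carrier R \<times> (carrier R - {\<zero>})) \<times> (carrier R \<times> (carrier R - {\<zero>}))"
    by (auto simp: frac_rel_def)
  show "refl_on (carrier R \<times> (carrier R - {\<zero>})) (frac_rel R)"
    by (auto simp: frac_rel_def refl_on_def)
  show "sym (frac_rel R)"
    by (auto simp: frac_rel_def sym_def)
  show "trans (frac_rel R)"
  proof (rule transI)
    fix p q s assume pq: "(p, q) \<in> frac_rel R" and qs: "(q, s) \<in> frac_rel R"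
    obtain a b c d e f where p: "p = (a, b)" and q: "q = (c, d)" and s: "s = (e, f)"
      by (metis surj_pair)
    have car: "a \<in> carrier R" "b \<in> carrier R" "c \<in> carrier R" "d \<in> carrier R"
        "e \<in> carrier R" "f \<in> carrier R" and nz: "b \<noteq> \<zero>" "d \<noteq> \<zero>" "f \<noteq> \<zero>"
      and 1: "a \<otimes> d = c \<otimes> b" and 2: "c \<otimes> f = e \<otimes> d"
      using pq qs by (auto simp: p q s frac_rel_def)
    have "d \<otimes> (a \<otimes> f) = (a \<otimes> d) \<otimes> f" using car by algebra
    also have "\<dots> = (c \<otimes> f) \<otimes> b" unfolding 1 using car by algebra
    also have "\<dots> = d \<otimes> (e \<otimes> b)" unfolding 2 using car by algebra
    finally have "a \<otimes> f = e \<otimes> b"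
      using car nz m_lcancel[of d "a \<otimes> f" "e \<otimes> b"] by simp
    then show "(p, s) \<in> frac_rel R"
      using car nz by (simp add: p s frac_rel_def)
  qed
qed

lemma frac_eq_iff:
  assumes "a \<in> carrier R" "b \<in> carrier R - {\<zero>}" "c \<in> carrier R" "d \<in> carrier R - {\<zero>}"
  shows "fraction R a b = fraction R c d \<longleftrightarrow> a \<otimes> d = c \<otimes> b"
proof -
  have "fraction R a b = fraction R c d \<longleftrightarrow> ((a, b), (c, d)) \<in> frac_rel R"
    unfolding fraction_def using assms
    by (intro eq_equiv_class_iff[OF equiv_frac_rel]) auto
  then show ?thesis using assms by (simp add: frac_rel_def)
qed

lemma carrier_frac_field:
  "carrier (frac_field R) = {fraction R a b |a b. a \<in> carrier R \<and> b \<in> carrier R - {\<zero>}}"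
  by (auto simp: frac_field_def quotient_def fraction_def)

lemma nonzero_mult:
  "b \<in> carrier R - {\<zero>} \<Longrightarrow> d \<in> carrier R - {\<zero>} \<Longrightarrow> b \<otimes> d \<in> carrier R - {\<zero>}"
  by (auto simp: integral_iff)

lemma frac_congruent_mult:
  "congruent2 (frac_rel R) (frac_rel R)
     (\<lambda>p q. (\<lambda>(a, b). \<lambda>(c, d). fraction R (a \<otimes> c) (b \<otimes> d)) p q)"
proof (rule congruent2I')
  fix p p' q q' assume pq: "(p, p') \<in> frac_rel R" "(q, q') \<in> frac_rel R"
  obtain a b c d e f g h where eq: "p = (a, b)" "p' = (c, d)" "q = (e, f)" "q' = (g, h)"
    by (metis surj_pair)
  have car: "a \<in> carrier R" "b \<in> carrier R" "c \<in> carrier R" "d \<in> carrier R"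
      "e \<in> carrier R" "f \<in> carrier R" "g \<in> carrier R" "h \<in> carrier R"
    and nz: "b \<noteq> \<zero>" "d \<noteq> \<zero>" "f \<noteq> \<zero>" "h \<noteq> \<zero>"
    and 1: "a \<otimes> d = c \<otimes> b" and 2: "e \<otimes> h = g \<otimes> f"
    using pq by (auto simp: eq frac_rel_def)
  have "(a \<otimes> e) \<otimes> (d \<otimes> h) = (a \<otimes> d) \<otimes> (e \<otimes> h)" using car by algebra
  also have "\<dots> = (c \<otimes> g) \<otimes> (b \<otimes> f)" unfolding 1 2 using car by algebra
  finally have "fraction R (a \<otimes> e) (b \<otimes> f) = fraction R (c \<otimes> g) (d \<otimes> h)"
    by (subst frac_eq_iff) (use car nz nonzero_mult in auto)
  then show "(\<lambda>(a, b). \<lambda>(c, d). fraction R (a \<otimes> c) (b \<otimes> d)) p q =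
      (\<lambda>(a, b). \<lambda>(c, d). fraction R (a \<otimes> c) (b \<otimes> d)) p' q'"
    by (simp add: eq)
qed

lemma frac_congruent_add:
  "congruent2 (frac_rel R) (frac_rel R)
     (\<lambda>p q. (\<lambda>(a, b). \<lambda>(c, d). fraction R (a \<otimes> d \<oplus> c \<otimes> b) (b \<otimes> d)) p q)"
proof (rule congruent2I')
  fix p p' q q' assume pq: "(p, p') \<in> frac_rel R" "(q, q') \<in> frac_rel R"
  obtain a b c d e f g h where eq: "p = (a, b)" "p' = (c, d)" "q = (e, f)" "q' = (g, h)"
    by (metis surj_pair)
  have car: "a \<in> carrier R" "b \<in> carrier R" "c \<in> carrier R" "d \<in> carrier R"
      "e \<in> carrier R" "f \<in> carrier R" "g \<in> carrier R" "h \<in> carrier R"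
    and nz: "b \<noteq> \<zero>" "d \<noteq> \<zero>" "f \<noteq> \<zero>" "h \<noteq> \<zero>"
    and 1: "a \<otimes> d = c \<otimes> b" and 2: "e \<otimes> h = g \<otimes> f"
    using pq by (auto simp: eq frac_rel_def)
  have "(a \<otimes> f \<oplus> e \<otimes> b) \<otimes> (d \<otimes> h) = (a \<otimes> d) \<otimes> (f \<otimes> h) \<oplus> (e \<otimes> h) \<otimes> (b \<otimes> d)"
    using car by algebra
  also have "\<dots> = (c \<otimes> h \<oplus> g \<otimes> d) \<otimes> (b \<otimes> f)" unfolding 1 2 using car by algebra
  finally have "fraction R (a \<otimes> f \<oplus> e \<otimes> b) (b \<otimes> f) = fraction R (c \<otimes> h \<oplus> g \<otimes> d) (d \<otimes> h)"
    by (subst frac_eq_iff) (use car nz nonzero_mult in auto)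
  then show "(\<lambda>(a, b). \<lambda>(c, d). fraction R (a \<otimes> d \<oplus> c \<otimes> b) (b \<otimes> d)) p q =
      (\<lambda>(a, b). \<lambda>(c, d). fraction R (a \<otimes> d \<oplus> c \<otimes> b) (b \<otimes> d)) p' q'"
    by (simp add: eq)
qed

lemma frac_mult:
  assumes "a \<in> carrier R" "b \<in> carrier R - {\<zero>}" "c \<in> carrier R" "d \<in> carrier R - {\<zero>}"
  shows "fraction R a b \<otimes>\<^bsub>frac_field R\<^esub> fraction R c d = fraction R (a \<otimes> c) (b \<otimes> d)"
  using UN_equiv_class2[OF equiv_frac_rel equiv_frac_rel frac_congruent_mult, of "(a, b)" "(c, d)"]
    assms by (simp add: frac_field_def fraction_def[of R a b] fraction_def[of R c d] split_def)

lemma frac_add: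
  assumes "a \<in> carrier R" "b \<in> carrier R - {\<zero>}" "c \<in> carrier R" "d \<in> carrier R - {\<zero>}"
  shows "fraction R a b \<oplus>\<^bsub>frac_field R\<^esub> fraction R c d = fraction R (a \<otimes> d \<oplus> c \<otimes> b) (b \<otimes> d)"
  using UN_equiv_class2[OF equiv_frac_rel equiv_frac_rel frac_congruent_add, of "(a, b)" "(c, d)"]
    assms by (simp add: frac_field_def fraction_def[of R a b] fraction_def[of R c d] split_def)

lemma frac_one: "\<one>\<^bsub>frac_field R\<^esub> = fraction R \<one> \<one>"
  and frac_zero: "\<zero>\<^bsub>frac_field R\<^esub> = fraction R \<zero> \<one>"
  by (simp_all add: frac_field_def)

lemma frac_in_carrier:
  "a \<in> carrier R \<Longrightarrow> b \<in> carrier R - {\<zero>} \<Longrightarrow> fraction R a b \<in> carrier (frac_field R)"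
  by (auto simp: carrier_frac_field)

lemma frac_fieldE:
  assumes "x \<in> carrier (frac_field R)"
  obtains a b where "a \<in> carrier R" "b \<in> carrier R" "b \<noteq> \<zero>" "x = fraction R a b"
  using assms by (auto simp: carrier_frac_field)

lemma cring_frac_field: "cring (frac_field R)"
proof (rule cringI)
  show "abelian_group (frac_field R)"
  proof (rule abelian_groupI)
    fix x assume "x \<in> carrier (frac_field R)"
    then obtain a b where x: "a \<in> carrier R" "b \<in> carrier R" "b \<noteq> \<zero>" "x = fraction R a b"
      by (rule frac_fieldE)
    show "\<zero>\<^bsub>frac_field R\<^esub> \<oplus>\<^bsub>frac_field R\<^esub> x = x"
      using x by (simp add: frac_zero frac_add)
    show "\<exists>y \<in> carrier (frac_field R). y \<oplus>\<^bsub>frac_field R\<^esub> x = \<zero>\<^bsub>frac_field R\<^esub>"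
    proof (rule bexI)
      have "((\<ominus> a) \<otimes> b \<oplus> a \<otimes> b) \<otimes> \<one> = \<zero> \<otimes> (b \<otimes> b)" using x by algebra
      then show "fraction R (\<ominus> a) b \<oplus>\<^bsub>frac_field R\<^esub> x = \<zero>\<^bsub>frac_field R\<^esub>"
        using x by (simp add: frac_zero frac_add frac_eq_iff integral_iff)
      show "fraction R (\<ominus> a) b \<in> carrier (frac_field R)"
        using x by (intro frac_in_carrier) auto
    qed
    fix y assume "y \<in> carrier (frac_field R)"
    then obtain c d where y: "c \<in> carrier R" "d \<in> carrier R" "d \<noteq> \<zero>" "y = fraction R c d"
      by (rule frac_fieldE)
    show "x \<oplus>\<^bsub>frac_field R\<^esub> y \<in> carrier (frac_field R)"
      using x y nonzero_mult by (simp add: frac_add frac_in_carrier)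
    show "x \<oplus>\<^bsub>frac_field R\<^esub> y = y \<oplus>\<^bsub>frac_field R\<^esub> x"
      using x y by (simp add: frac_add a_comm m_comm)
    fix z assume "z \<in> carrier (frac_field R)"
    then obtain e f where z: "e \<in> carrier R" "f \<in> carrier R" "f \<noteq> \<zero>" "z = fraction R e f"
      by (rule frac_fieldE)
    have "(a \<otimes> d \<oplus> c \<otimes> b) \<otimes> f \<oplus> e \<otimes> (b \<otimes> d) = a \<otimes> (d \<otimes> f) \<oplus> (c \<otimes> f \<oplus> e \<otimes> d) \<otimes> b"
      using x(1-3) y(1-3) z(1-3) by (simp add: l_distr r_distr m_ac a_assoc)
    then show "x \<oplus>\<^bsub>frac_field R\<^esub> y \<oplus>\<^bsub>frac_field R\<^esub> z = x \<oplus>\<^bsub>frac_field R\<^esub> (y \<oplus>\<^bsub>frac_field R\<^esub> z)"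
      using x y z by (simp add: frac_add integral_iff m_assoc)
  next
    show "\<zero>\<^bsub>frac_field R\<^esub> \<in> carrier (frac_field R)"
      by (simp add: frac_zero frac_in_carrier)
  qed
  show "comm_monoid (frac_field R)"
  proof (rule comm_monoidI)
    show "\<one>\<^bsub>frac_field R\<^esub> \<in> carrier (frac_field R)"
      by (simp add: frac_one frac_in_carrier)
    fix x assume "x \<in> carrier (frac_field R)"
    then obtain a b where x: "a \<in> carrier R" "b \<in> carrier R" "b \<noteq> \<zero>" "x = fraction R a b"
      by (rule frac_fieldE)
    show "\<one>\<^bsub>frac_field R\<^esub> \<otimes>\<^bsub>frac_field R\<^esub> x = x"
      using x by (simp add: frac_one frac_mult)
    fix y assume "y \<in> carrier (frac_field R)"
    then obtain c d where y: "c \<in> carrier R" "d \<in> carrier R" "d \<noteq> \<zero>" "y = fraction R c d"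
      by (rule frac_fieldE)
    show "x \<otimes>\<^bsub>frac_field R\<^esub> y \<in> carrier (frac_field R)"
      using x y nonzero_mult by (simp add: frac_mult frac_in_carrier)
    show "x \<otimes>\<^bsub>frac_field R\<^esub> y = y \<otimes>\<^bsub>frac_field R\<^esub> x"
      using x y by (simp add: frac_mult m_comm)
    fix z assume "z \<in> carrier (frac_field R)"
    then obtain e f where z: "e \<in> carrier R" "f \<in> carrier R" "f \<noteq> \<zero>" "z = fraction R e f"
      by (rule frac_fieldE)
    show "x \<otimes>\<^bsub>frac_field R\<^esub> y \<otimes>\<^bsub>frac_field R\<^esub> z = x \<otimes>\<^bsub>frac_field R\<^esub> (y \<otimes>\<^bsub>frac_field R\<^esub> z)"
      using x y z by (simp add: frac_mult integral_iff m_assoc)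
  qed
  fix x y z
  assume X: "x \<in> carrier (frac_field R)" and Y: "y \<in> carrier (frac_field R)"
    and Z: "z \<in> carrier (frac_field R)"
  obtain a b where x: "a \<in> carrier R" "b \<in> carrier R" "b \<noteq> \<zero>" "x = fraction R a b"
    using X by (rule frac_fieldE)
  obtain c d where y: "c \<in> carrier R" "d \<in> carrier R" "d \<noteq> \<zero>" "y = fraction R c d"
    using Y by (rule frac_fieldE)
  obtain e f where z: "e \<in> carrier R" "f \<in> carrier R" "f \<noteq> \<zero>" "z = fraction R e f"
    using Z by (rule frac_fieldE)
  have "((a \<otimes> d \<oplus> c \<otimes> b) \<otimes> e) \<otimes> ((b \<otimes> f) \<otimes> (d \<otimes> f)) =
      ((a \<otimes> e) \<otimes> (d \<otimes> f) \<oplus> (c \<otimes> e) \<otimes> (b \<otimes> f)) \<otimes> ((b \<otimes> d) \<otimes> f)"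
    using x(1-3) y(1-3) z(1-3) by (simp add: l_distr r_distr m_ac)
  then show "(x \<oplus>\<^bsub>frac_field R\<^esub> y) \<otimes>\<^bsub>frac_field R\<^esub> z =
      x \<otimes>\<^bsub>frac_field R\<^esub> z \<oplus>\<^bsub>frac_field R\<^esub> y \<otimes>\<^bsub>frac_field R\<^esub> z"
    using x y z by (simp add: frac_mult frac_add frac_eq_iff integral_iff)
qed

lemma field_frac_field: "field (frac_field R)"
proof -
  interpret F: cring "frac_field R" by (rule cring_frac_field)
  have 01: "\<zero>\<^bsub>frac_field R\<^esub> \<noteq> \<one>\<^bsub>frac_field R\<^esub>"
    by (simp add: frac_zero frac_one frac_eq_iff)
  show ?thesis
  proof (rule F.cring_fieldI2[OF 01])
    fix x assume X: "x \<in> carrier (frac_field R)" and nz: "x \<noteq> \<zero>\<^bsub>frac_field R\<^esub>"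
    from X obtain a b where x: "a \<in> carrier R" "b \<in> carrier R" "b \<noteq> \<zero>" "x = fraction R a b"
      by (rule frac_fieldE)
    have a: "a \<noteq> \<zero>" using nz x by (auto simp: frac_zero frac_eq_iff)
    show "\<exists>y \<in> carrier (frac_field R). x \<otimes>\<^bsub>frac_field R\<^esub> y = \<one>\<^bsub>frac_field R\<^esub>"
    proof (rule bexI)
      show "x \<otimes>\<^bsub>frac_field R\<^esub> fraction R b a = \<one>\<^bsub>frac_field R\<^esub>"
        using x a by (simp add: frac_mult frac_one frac_eq_iff integral_iff m_comm)
      show "fraction R b a \<in> carrier (frac_field R)"
        using x a by (simp add: frac_in_carrier)
    qed
  qed
qed

lemma frac_embed_hom: "frac_embed R \<in> ring_hom R (frac_field R)"
  by (rule ring_hom_memI) (auto simp: frac_embed_def frac_in_carrier frac_mult frac_add frac_one)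

lemma inj_on_frac_embed: "inj_on (frac_embed R) (carrier R)"
  by (auto simp: inj_on_def frac_embed_def frac_eq_iff)

lemma frac_eq_quotient:
  assumes "a \<in> carrier R" "b \<in> carrier R - {\<zero>}"
  shows "fraction R a b \<otimes>\<^bsub>frac_field R\<^esub> frac_embed R b = frac_embed R a"
  using assms by (simp add: frac_embed_def frac_mult frac_eq_iff)

end


section \<open>The chain algebra and the chain semigroup\<close>

text \<open>Monomials are finitely supported exponent functions \<^typ>\<open>'a \<Rightarrow>\<^sub>0 nat\<close>. The polynomial ring
  \<open>\<bbbK>[x : x \<in> P]\<close> consists of the polynomials all of whose monomials are supported in \<open>P\<close>.\<close>

definition poly_ring_in :: "'a set \<Rightarrow> (('a \<Rightarrow>\<^sub>0 nat) \<Rightarrow>\<^sub>0 'k::field) ring" where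
  "poly_ring_in P =
     \<lparr>carrier = {p. \<forall>m \<in> Poly_Mapping.keys p. Poly_Mapping.keys m \<subseteq> P},
      mult = (*), one = 1, zero = 0, add = (+)\<rparr>"

definition const_poly :: "'k::field \<Rightarrow> (('a \<Rightarrow>\<^sub>0 nat) \<Rightarrow>\<^sub>0 'k)" where
  "const_poly c = Poly_Mapping.single 0 c"

definition var_poly :: "'a \<Rightarrow> (('a \<Rightarrow>\<^sub>0 nat) \<Rightarrow>\<^sub>0 'k::field)" where
  "var_poly x = Poly_Mapping.single (Poly_Mapping.single x 1) 1"

definition chain_monomial :: "'a set \<Rightarrow> (('a \<Rightarrow>\<^sub>0 nat) \<Rightarrow>\<^sub>0 'k::field)" where
  "chain_monomial C = (\<Prod>x\<in>C. var_poly x)"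

text \<open>The \<open>\<bbbK>\<close>-subalgebra generated by a set is the subring generated by that set together with the
  constants.\<close>

definition chain_algebra :: "'a set \<Rightarrow> 'a rel \<Rightarrow> (('a \<Rightarrow>\<^sub>0 nat) \<Rightarrow>\<^sub>0 'k::field) ring" where
  "chain_algebra P r = (poly_ring_in P)
     \<lparr>carrier := generate_ring (poly_ring_in P)
        (range const_poly \<union> chain_monomial ` maximal_chains r)\<rparr>"

text \<open>Functions \<open>P \<rightarrow> \<nat>\<close> are rendered as exponent functions supported in \<open>P\<close>. The type argument
  supplies the field \<open>\<bbbK>\<close>.\<close>

definition chain_semigroup :: "'k::field itself \<Rightarrow> 'a set \<Rightarrow> 'a rel \<Rightarrow> ('a \<Rightarrow>\<^sub>0 nat) set" where
  "chain_semigroup _ P r =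
     {f. Poly_Mapping.keys f \<subseteq> P \<and>
         (\<Prod>x\<in>P. var_poly x ^ Poly_Mapping.lookup f x) \<in>
           carrier (chain_algebra P r :: (('a \<Rightarrow>\<^sub>0 nat) \<Rightarrow>\<^sub>0 'k) ring)}"

text \<open>The inclusion of \<open>\<nat>\<^sup>P\<close> into \<open>\<int>\<^sup>P\<close>.\<close>

definition int_exponents :: "('a \<Rightarrow>\<^sub>0 nat) \<Rightarrow> ('a \<Rightarrow>\<^sub>0 int)" where
  "int_exponents = Poly_Mapping.map int"

lemma lookup_int_exponents:
  "Poly_Mapping.lookup (int_exponents f) x = int (Poly_Mapping.lookup f x)"
  by (simp add: int_exponents_def Poly_Mapping.map.rep_eq when_def)

lemma cring_poly_ring_in: "cring (poly_ring_in P :: (('a \<Rightarrow>\<^sub>0 nat) \<Rightarrow>\<^sub>0 'k::field) ring)"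
proof -
  let ?R = "poly_ring_in P :: (('a \<Rightarrow>\<^sub>0 nat) \<Rightarrow>\<^sub>0 'k) ring"
  have add: "p + q \<in> carrier ?R" if "p \<in> carrier ?R" "q \<in> carrier ?R" for p q
    using that Poly_Mapping.keys_add[of p q] by (auto simp: poly_ring_in_def)
  have mult: "p * q \<in> carrier ?R" if "p \<in> carrier ?R" "q \<in> carrier ?R" for p q
  proof -
    have "Poly_Mapping.keys m \<subseteq> P" if m: "m \<in> Poly_Mapping.keys (p * q)" for m
    proof -
      obtain a b where "m = a + b" "a \<in> Poly_Mapping.keys p" "b \<in> Poly_Mapping.keys q"
        using m keys_mult[of p q] by auto
      then show ?thesis
        using \<open>p \<in> carrier ?R\<close> \<open>q \<in> carrier ?R\<close> Poly_Mapping.keys_add[of a b]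
        by (fastforce simp: poly_ring_in_def)
    qed
    then show ?thesis by (simp add: poly_ring_in_def)
  qed
  have neg: "- p \<in> carrier ?R" if "p \<in> carrier ?R" for p
    using that by (simp add: poly_ring_in_def)
  have zero_one: "0 \<in> carrier ?R" "1 \<in> carrier ?R"
    by (simp_all add: poly_ring_in_def)
  have ops: "(\<otimes>\<^bsub>?R\<^esub>) = (*)" "(\<oplus>\<^bsub>?R\<^esub>) = (+)" "\<one>\<^bsub>?R\<^esub> = 1" "\<zero>\<^bsub>?R\<^esub> = 0"
    by (simp_all add: poly_ring_in_def)
  have inverse: "\<exists>q \<in> carrier ?R. p + q = 0" if "p \<in> carrier ?R" for p
    using neg[OF that] by (intro bexI[of _ "- p"]) simp_all
  show ?thesis
    by (intro cringI abelian_groupI comm_monoidI; unfold ops)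
      (simp_all add: add mult zero_one inverse algebra_simps)
qed

end

(*
Let L_0, ..., L_{n-1} be the levels of the pure poset P. A function f on P is a sum of indicators of
maximal chains iff it has the same total on all levels and f(X) <= f(N(X)) for every subset X of a
level, where N(X) is the set of elements of the next level above some element of X: by Hall's theorem,
f can then be decomposed into chains one level at a time. These conditions are linear equations and
inequalities, which makes the chain semigroup normal; it also shows that alpha - beta lies in it
whenever gamma + k (alpha - beta) does for all k.

For K[C_P], let a/b be integral over it. Then c a^k is divisible by b^k for all k, where c is a power
of b. Comparing leading exponents in a monomial order, the previous property gives a monomial of the
algebra by which the leading exponents of a and b differ. Subtracting the corresponding multiple of b
from a lowers the leading exponent and preserves the hypothesis, so a is a multiple of b.
*)
theory Submission
  imports Defs "HOL-Computational_Algebra.Primes"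
begin

text \<open>Purity is what makes levels exist: splicing two maximal chains at a common element x
  gives a chain, and the bound on its size forces x to have equally many elements below it in both.
  Hall's theorem is what makes the decomposition integral. In the ring, if the integral equation of
  a/b has degree n, every power of a/b is a combination of the first n powers, so c = b^(n-1) works
  for all k. Leading exponents then only tell that lead(c) + k (lead(a) - lead(b)) lies in the
  monoid. The error term lead(c) does not depend on k, and a linear inequality forgets it as k
  grows. This is why saturation is formulated for all k and with an additional member of the monoid,
  instead of by the divisibility in the definition of normality. The remainder a' = a - b d inherits
  the hypothesis via the mixed products c a^i a'^j, since expanding one factor a' raises the
  exponent of a.\<close>

section \<open>Hall's theorem\<close>

text \<open>Rado's proof: if some \<open>A i\<close> has two elements, one of them can be deleted
  without destroying Hall's condition, because violators J and K for the two deletions would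
  contradict submodularity of the size of a union. Once all sets are singletons, the condition for
  pairs is injectivity.\<close>

lemma hall_choice:
  fixes A :: "'i \<Rightarrow> 'b set"
  assumes "finite I" and "\<And>i. i \<in> I \<Longrightarrow> finite (A i)"
    and "\<And>J. J \<subseteq> I \<Longrightarrow> card J \<le> card (\<Union>(A ` J))"
  shows "\<exists>f. inj_on f I \<and> (\<forall>i\<in>I. f i \<in> A i)"
  using assms(2,3)
proof (induction "\<Sum>i\<in>I. card (A i)" arbitrary: A rule: less_induct)
  case less
  show ?case
  proof (cases "\<exists>i\<in>I. \<exists>x\<in>A i. \<exists>y\<in>A i. x \<noteq> y")
    case True
    then obtain i x y where i: "i \<in> I" and xy: "x \<in> A i" "y \<in> A i" "x \<noteq> y" by blast
    define B where "B z = A(i := A i - {z})" for z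
    have fin_UN: "finite (\<Union>(B z ` J))" if "J \<subseteq> I" for z J
      using that less.prems(1) finite_subset[OF that \<open>finite I\<close>] by (auto simp: B_def)
    have "(\<forall>J\<subseteq>I. card J \<le> card (\<Union>(B x ` J))) \<or> (\<forall>J\<subseteq>I. card J \<le> card (\<Union>(B y ` J)))"
    proof (rule ccontr)
      assume "\<not> ?thesis"
      then obtain J K where J: "J \<subseteq> I" "card (\<Union>(B x ` J)) < card J"
        and K: "K \<subseteq> I" "card (\<Union>(B y ` K)) < card K"
        by (auto simp: not_le)
      let ?U = "\<Union>(B x ` J)" and ?V = "\<Union>(B y ` K)"
      \<comment> \<open>A violator must contain i, since the deletion changes no other set.\<close>
      have in_set: "i \<in> L" if "L \<subseteq> I" "card (\<Union>(B z ` L)) < card L" for L z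
      proof (rule ccontr)
        assume "i \<notin> L"
        then have "\<Union>(B z ` L) = \<Union>(A ` L)" by (auto simp: B_def)
        then show False using that less.prems(2)[of L] by simp
      qed
      have iJ: "i \<in> J" and iK: "i \<in> K" using in_set J K by blast+
      have fJ: "finite J" and fK: "finite K" using J K \<open>finite I\<close> finite_subset by auto
      have fU: "finite ?U" and fV: "finite ?V" using fin_UN J K by auto
      \<comment> \<open>At k = i one deletion keeps y and the other keeps x, so together they lose
        nothing.\<close>
      have "A k \<subseteq> ?U \<union> ?V" if "k \<in> J \<union> K" for k
        using that iJ iK xy(3) by (cases "k = i") (auto simp: B_def)
      then have "\<Union>(A ` (J \<union> K)) \<subseteq> ?U \<union> ?V" by blast
      then have "card (\<Union>(A ` (J \<union> K))) \<le> card (?U \<union> ?V)"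
        by (rule card_mono[OF finite_UnI[OF fU fV]])
      moreover have "card (J \<union> K) \<le> card (\<Union>(A ` (J \<union> K)))"
        by (rule less.prems(2)[OF Un_least[OF J(1) K(1)]])
      \<comment> \<open>Away from i both deletions leave \<open>A\<close> as it is, so a common
        index contributes to both unions.\<close>
      moreover have "\<Union>(A ` (J \<inter> K - {i})) \<subseteq> ?U \<inter> ?V"
        by (auto simp: B_def split: if_splits)
      then have "card (\<Union>(A ` (J \<inter> K - {i}))) \<le> card (?U \<inter> ?V)"
        by (rule card_mono[OF finite_Int[OF disjI1[OF fU]]])
      moreover have "card (J \<inter> K - {i}) \<le> card (\<Union>(A ` (J \<inter> K - {i})))"
        using J(1) by (intro less.prems(2)) blast
      moreover have "card (J \<inter> K - {i}) + 1 = card (J \<inter> K)"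
        using iJ iK fJ by (metis IntI Suc_eq_plus1 card_Suc_Diff1 finite_Int)
      moreover have "card J + card K = card (J \<union> K) + card (J \<inter> K)"
        using fJ fK by (rule card_Un_Int)
      moreover have "card ?U + card ?V = card (?U \<union> ?V) + card (?U \<inter> ?V)"
        using fU fV by (rule card_Un_Int)
      \<comment> \<open>The estimates give \<open>card ?U + card ?V >= card J + card K - 1\<close>,
        the two violations at most \<open>card J + card K - 2\<close>.\<close>
      ultimately show False using J(2) K(2) by linarith
    qed
    then obtain z where z: "z \<in> A i" "\<And>J. J \<subseteq> I \<Longrightarrow> card J \<le> card (\<Union>(B z ` J))"
      using xy by blast
    have "(\<Sum>k\<in>I. card (B z k)) < (\<Sum>k\<in>I. card (A k))"
    proof (rule sum_strict_mono_ex1)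
      show "\<forall>k\<in>I. card (B z k) \<le> card (A k)"
        using less.prems(1) by (auto simp: B_def intro: card_mono)
      show "\<exists>k\<in>I. card (B z k) < card (A k)"
        using card_Diff1_less[OF less.prems(1)[OF i] z(1)] i by (intro bexI[of _ i]) (simp_all add: B_def)
    qed (fact \<open>finite I\<close>)
    then have "\<exists>f. inj_on f I \<and> (\<forall>k\<in>I. f k \<in> B z k)"
      using less.prems(1) by (intro less.hyps z(2)) (auto simp: B_def)
    then obtain f where "inj_on f I" "\<forall>k\<in>I. f k \<in> B z k" by blast
    then show ?thesis by (intro exI[of _ f]) (auto simp: B_def split: if_splits)
  next
    case False
    have "\<exists>x. A i = {x}" if "i \<in> I" for i
    proof -
      have "card {i} \<le> card (A i)" using less.prems(2)[of "{i}"] that by simp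
      then have "A i \<noteq> {}" by auto
      then show ?thesis using False that by blast
    qed
    then obtain f where f: "A i = {f i}" if "i \<in> I" for i by metis
    have "inj_on f I"
    proof (rule inj_onI, rule ccontr)
      fix i j assume "i \<in> I" "j \<in> I" "f i = f j" "i \<noteq> j"
      then show False using less.prems(2)[of "{i, j}"] f by simp
    qed
    then show ?thesis using f by (intro exI[of _ f]) simp
  qed
qed

text \<open>Hall's theorem with capacities: each y is replaced by \<open>g y\<close> copies, so an
  injective choice uses y at most \<open>g y\<close> times. The capacities add up to the number d of
  choices, hence all these bounds are attained.\<close>

lemma hall_assignment:
  fixes g :: "'a \<Rightarrow> nat" and S :: "nat \<Rightarrow> 'a set"
  assumes "finite Y" and "sum g Y = d" and "\<And>j. j < d \<Longrightarrow> S j \<subseteq> Y"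
    and "\<And>J. J \<subseteq> {..<d} \<Longrightarrow> card J \<le> sum g (\<Union>(S ` J))"
  shows "\<exists>f. (\<forall>j<d. f j \<in> S j) \<and> (\<forall>y\<in>Y. card {j \<in> {..<d}. f j = y} = g y)"
proof -
  define A where "A j = Sigma (S j) (\<lambda>y. {..<g y})" for j
  have fin: "finite (S j)" if "j < d" for j
    using assms(1,3) that finite_subset by blast
  have "card J \<le> card (\<Union>(A ` J))" if "J \<subseteq> {..<d}" for J
  proof -
    have "\<Union>(A ` J) = Sigma (\<Union>(S ` J)) (\<lambda>y. {..<g y})" by (auto simp: A_def)
    moreover have "finite (\<Union>(S ` J))"
      using that fin by (meson finite_UN_I finite_lessThan finite_subset lessThan_iff subsetD)
    ultimately show ?thesis using assms(4)[OF that] by simp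
  qed
  then obtain h where h: "inj_on h {..<d}" "\<forall>j\<in>{..<d}. h j \<in> A j"
    using hall_choice[of "{..<d}" A] fin by (auto simp: A_def)
  define f where "f j = fst (h j)" for j
  have mem: "f j \<in> S j" "h j \<in> {f j} \<times> {..<g (f j)}" if "j < d" for j
    using h(2) that by (force simp: f_def A_def)+
  have le: "card {j \<in> {..<d}. f j = y} \<le> g y" for y
  proof -
    have "card {j \<in> {..<d}. f j = y} = card (h ` {j \<in> {..<d}. f j = y})"
      using h(1) by (intro card_image[symmetric]) (auto intro: inj_on_subset)
    also have "\<dots> \<le> card ({y} \<times> {..<g y})"
      using mem(2) by (intro card_mono image_subsetI) auto
    finally show ?thesis by (simp add: card_cartesian_product)
  qed
  have "f ` {..<d} \<subseteq> Y" using mem(1) assms(3) by blast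
  then have "(\<Sum>y\<in>Y. card {j \<in> {..<d}. f j = y}) = sum g Y"
    using sum.group[of "{..<d}" Y f "\<lambda>_. 1::nat"] assms(1,2) by simp
  then have "card {j \<in> {..<d}. f j = y} = g y" if "y \<in> Y" for y
    using sum_mono_inv[of _ Y g y] le that assms(1) by blast
  then show ?thesis using mem(1) by blast
qed

section \<open>Levels and decompositions into chains\<close>

definition indicator_exponent :: "'a set \<Rightarrow> ('a \<Rightarrow>\<^sub>0 nat)" where
  "indicator_exponent C = (\<Sum>x\<in>C. Poly_Mapping.single x 1)"

lemma lookup_indicator_exponent:
  "finite C \<Longrightarrow> Poly_Mapping.lookup (indicator_exponent C) x = (if x \<in> C then 1 else 0)"
  by (simp add: indicator_exponent_def lookup_sum lookup_single when_def)

lemma keys_indicator_exponent: "finite C \<Longrightarrow> Poly_Mapping.keys (indicator_exponent C) = C"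
  by (auto simp: in_keys_iff lookup_indicator_exponent split: if_splits)

lemma sum_lookup_indicator_exponent:
  assumes "finite C" "finite X"
  shows "sum (Poly_Mapping.lookup (indicator_exponent C)) X = card (C \<inter> X)"
proof -
  have "X \<inter> {x. x \<in> C} = C \<inter> X" by auto
  then show ?thesis using assms by (simp add: lookup_indicator_exponent sum.If_cases)
qed

lemma add_closed_hull: "add_closed (add_closed hull S)"
  by (rule hull_in) (auto simp: add_closed_def)

text \<open>\<open>add_closed hull\<close> generates only a semigroup; adjoining 0 makes it a
  monoid.\<close>

definition chain_monoid :: "'a rel \<Rightarrow> ('a \<Rightarrow>\<^sub>0 nat) set" where
  "chain_monoid r = add_closed hull (insert 0 (indicator_exponent ` maximal_chains r))"

lemma zero_in_chain_monoid: "0 \<in> chain_monoid r"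
  by (simp add: chain_monoid_def hull_inc)

lemma indicator_in_chain_monoid: "C \<in> maximal_chains r \<Longrightarrow> indicator_exponent C \<in> chain_monoid r"
  by (simp add: chain_monoid_def hull_inc)

lemma chain_monoid_add: "f \<in> chain_monoid r \<Longrightarrow> g \<in> chain_monoid r \<Longrightarrow> f + g \<in> chain_monoid r"
  using add_closed_hull unfolding add_closed_def chain_monoid_def by blast

lemma chain_monoid_sum:
  "(\<And>j. j \<in> J \<Longrightarrow> f j \<in> chain_monoid r) \<Longrightarrow> sum f J \<in> chain_monoid r"
  by (induction J rule: infinite_finite_induct) (auto simp: zero_in_chain_monoid chain_monoid_add)

text \<open>\<open>n\<close> counts elements rather than steps, so levels are indexed by k < n and
  the empty poset is the case n = 0.\<close>

locale finite_pure_poset =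
  fixes P :: "'a set" and r :: "'a rel" and n :: nat
  assumes finite_P: "finite P" and order: "partial_order_on P r"
    and card_maximal_chain: "C \<in> maximal_chains r \<Longrightarrow> card C = n"
begin

lemma refl_r: "x \<in> P \<Longrightarrow> (x, x) \<in> r"
  and trans_r: "(x, y) \<in> r \<Longrightarrow> (y, z) \<in> r \<Longrightarrow> (x, z) \<in> r"
  and antisym_r: "(x, y) \<in> r \<Longrightarrow> (y, x) \<in> r \<Longrightarrow> x = y"
  and r_subset: "r \<subseteq> P \<times> P"
  using partial_order_onD[OF order] unfolding refl_on_def
  by (blast dest: transD antisymD)+

lemma chain_subset: "C \<in> Chains r \<Longrightarrow> C \<subseteq> P"
  using r_subset by (fastforce simp: Chains_def)

lemma finite_chain: "C \<in> Chains r \<Longrightarrow> finite C"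
  using chain_subset finite_P finite_subset by blast

lemma maximal_chainD: "C \<in> maximal_chains r \<Longrightarrow> C \<in> Chains r"
  by (simp add: maximal_chains_def)

lemma finite_maximal_chains: "finite (maximal_chains r)"
  by (rule finite_subset[of _ "Pow P"]) (use chain_subset maximal_chainD finite_P in auto)

lemma chain_extend:
  assumes "C \<in> Chains r" obtains D where "D \<in> maximal_chains r" "C \<subseteq> D"
proof -
  have "finite (Chains r)"
    by (rule finite_subset[of _ "Pow P"]) (use chain_subset finite_P in auto)
  from finite_has_maximal2[OF this assms] obtain D where
    "D \<in> Chains r" "C \<subseteq> D" "\<forall>E\<in>Chains r. D \<subseteq> E \<longrightarrow> D = E" by auto
  then show ?thesis by (intro that) (auto simp: maximal_chains_def)
qed

lemma card_chain_le:
  assumes "C \<in> Chains r" shows "card C \<le> n"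
proof -
  obtain D where D: "D \<in> maximal_chains r" "C \<subseteq> D" using assms by (rule chain_extend)
  then have "card C \<le> card D" by (intro card_mono finite_chain maximal_chainD)
  then show ?thesis using card_maximal_chain[OF D(1)] by simp
qed

lemma maximal_chainI:
  assumes "C \<in> Chains r" "card C = n" shows "C \<in> maximal_chains r"
proof -
  obtain D where D: "D \<in> maximal_chains r" "C \<subseteq> D" using assms(1) by (rule chain_extend)
  moreover have "card C = card D" using assms(2) card_maximal_chain[OF D(1)] by simp
  ultimately have "C = D" by (intro card_subset_eq finite_chain maximal_chainD)
  then show ?thesis using D(1) by simp
qed

section \<open>Levels of a pure poset\<close>

definition below :: "'a set \<Rightarrow> 'a \<Rightarrow> 'a set" where
  "below C x = {y \<in> C. (y, x) \<in> r \<and> y \<noteq> x}"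

text \<open>The rank of x, measured inside some maximal chain through x; by \<open>level_iff\<close>
  the choice of the chain does not matter.\<close>

definition level :: "nat \<Rightarrow> 'a set" where
  "level k = {x. \<exists>C \<in> maximal_chains r. x \<in> C \<and> card (below C x) = k}"

lemma level_subset: "level k \<subseteq> P"
  using chain_subset maximal_chainD by (auto simp: level_def)

lemma finite_level: "finite (level k)"
  using level_subset finite_P finite_subset by blast

text \<open>Splice the part of \<open>C\<close> below \<open>x\<close> with the part of \<open>D\<close> above \<open>x\<close>.\<close>

lemma card_below_le:
  assumes C: "C \<in> maximal_chains r" "x \<in> C" and D: "D \<in> maximal_chains r" "x \<in> D"
  shows "card (below C x) \<le> card (below D x)"
proof -
  let ?U = "D - below D x"
  have CC: "C \<in> Chains r" "D \<in> Chains r" using C D maximal_chainD by auto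
  have up: "(x, y) \<in> r" if "y \<in> ?U" for y
    using that CC(2) D(2) by (fastforce simp: Chains_def below_def)
  have "below C x \<union> ?U \<in> Chains r"
    unfolding Chains_def
  proof (rule CollectI, intro ballI)
    fix a b assume "a \<in> below C x \<union> ?U" "b \<in> below C x \<union> ?U"
    then consider "a \<in> C" "b \<in> C" | "a \<in> D" "b \<in> D" | "a \<in> below C x" "b \<in> ?U"
      | "b \<in> below C x" "a \<in> ?U"
      by (auto simp: below_def)
    then show "(a, b) \<in> r \<or> (b, a) \<in> r"
    proof cases
      case 3 then show ?thesis using up trans_r[of a x b] by (simp add: below_def)
    next
      case 4 then show ?thesis using up trans_r[of b x a] by (simp add: below_def)
    qed (use CC in \<open>auto simp: Chains_def\<close>)
  qed
  \<comment> \<open>Purity bounds the spliced chain by n, and its part \<open>?U\<close> already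
    takes \<open>n - card (below D x)\<close> elements.\<close>
  then have "card (below C x \<union> ?U) \<le> n" by (rule card_chain_le)
  moreover have "below C x \<inter> ?U = {}"
    using up antisym_r by (fastforce simp: below_def)
  moreover have fin: "finite C" "finite D" using CC finite_chain by auto
  moreover have "card ?U = n - card (below D x)"
    using card_maximal_chain[OF D(1)] fin by (subst card_Diff_subset) (auto simp: below_def)
  moreover have "card (below D x) \<le> n"
    using card_maximal_chain[OF D(1)] fin card_mono[of D "below D x"] by (auto simp: below_def)
  moreover have "finite (below C x)" "finite ?U" using fin by (auto simp: below_def)
  ultimately show ?thesis using card_Un_disjoint[of "below C x" ?U] by linarith
qed

text \<open>\<open>card_below_le\<close> also holds with the two chains exchanged, so it is an
  equality.\<close>

lemma level_iff:
  assumes "C \<in> maximal_chains r" "x \<in> C"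
  shows "x \<in> level k \<longleftrightarrow> card (below C x) = k"
proof
  assume "x \<in> level k"
  then obtain D where "D \<in> maximal_chains r" "x \<in> D" "card (below D x) = k"
    by (auto simp: level_def)
  then show "card (below C x) = k"
    using card_below_le[OF assms, of D] card_below_le[of D x C] assms by simp
qed (use assms in \<open>auto simp: level_def\<close>)

lemma level_disjoint: "x \<in> level k \<Longrightarrow> x \<in> level l \<Longrightarrow> k = l"
proof -
  assume k: "x \<in> level k" and l: "x \<in> level l"
  from k obtain C where C: "C \<in> maximal_chains r" "x \<in> C" by (auto simp: level_def)
  show "k = l" using k l level_iff[OF C] by simp
qed

lemma below_less:
  assumes "C \<in> Chains r" "x \<in> C" "(x, y) \<in> r" "x \<noteq> y"
  shows "card (below C x) < card (below C y)"
proof (rule psubset_card_mono)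
  show "finite (below C y)" using finite_chain[OF assms(1)] by (simp add: below_def)
  have "below C x \<subseteq> below C y"
    using assms(3,4) trans_r antisym_r by (fastforce simp: below_def)
  moreover have "x \<in> below C y - below C x" using assms by (simp add: below_def)
  ultimately show "below C x \<subset> below C y" by blast
qed

text \<open>The count increases strictly along C, so it takes n distinct values below n.\<close>

lemma bij_betw_card_below:
  assumes "C \<in> maximal_chains r"
  shows "bij_betw (\<lambda>x. card (below C x)) C {..<n}"
proof -
  have C: "C \<in> Chains r" "finite C" "card C = n"
    using assms maximal_chainD finite_chain card_maximal_chain by auto
  have inj: "inj_on (\<lambda>x. card (below C x)) C"
  proof (rule inj_onI, rule ccontr)
    fix x y assume xy: "x \<in> C" "y \<in> C" "card (below C x) = card (below C y)" "x \<noteq> y"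
    then have "(x, y) \<in> r \<or> (y, x) \<in> r" using C(1) by (auto simp: Chains_def)
    then show False using below_less[OF C(1)] xy by (metis less_irrefl)
  qed
  have "card (below C x) < card C" if "x \<in> C" for x
    by (rule psubset_card_mono) (use C that in \<open>auto simp: below_def\<close>)
  then have "(\<lambda>x. card (below C x)) ` C \<subseteq> {..<n}" using C(3) by auto
  then have "(\<lambda>x. card (below C x)) ` C = {..<n}"
    using inj C(3) by (intro card_subset_eq) (auto simp: card_image)
  then show ?thesis using inj by (simp add: bij_betw_def)
qed

lemma chain_Int_level:
  assumes "C \<in> maximal_chains r" "k < n"
  obtains x where "C \<inter> level k = {x}"
proof -
  have bij: "bij_betw (\<lambda>x. card (below C x)) C {..<n}"
    using bij_betw_card_below assms by blast
  then have "k \<in> (\<lambda>x. card (below C x)) ` C"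
    using assms(2) by (simp add: bij_betw_imp_surj_on)
  then obtain x where x: "x \<in> C" "card (below C x) = k" by blast
  then have "C \<inter> level k = {x}"
    using bij level_iff[OF assms(1)] by (auto simp: bij_betw_def inj_on_def)
  then show ?thesis by (rule that)
qed

lemma in_some_level:
  assumes "x \<in> P" obtains k where "k < n" "x \<in> level k"
proof -
  have "{x} \<in> Chains r" using refl_r[OF assms] by (simp add: Chains_def)
  then obtain C where C: "C \<in> maximal_chains r" "x \<in> C" by (meson chain_extend insert_subset)
  have "card (below C x) \<in> {..<n}"
    using bij_betw_card_below[OF C(1)] C(2) by (rule bij_betwE[rule_format])
  then show ?thesis
    using level_iff[OF C] by (intro that[of "card (below C x)"]) simp_all
qed

section \<open>Hall's inequalities between consecutive levels\<close>

text \<open>This is the N(X) of the overview; \<open>N\<close> later denotes a set of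
  exponents.\<close>

definition upper :: "nat \<Rightarrow> 'a set \<Rightarrow> 'a set" where
  "upper k X = {y \<in> level (Suc k). \<exists>x\<in>X. (x, y) \<in> r}"

lemma finite_upper: "finite (upper k X)"
  using finite_level by (simp add: upper_def)

text \<open>C meets level k in a single element x, and its element y in the next level lies above x,
  since otherwise y would have fewer elements of C below it than x. So C cannot meet X without
  meeting \<open>upper k X\<close>.\<close>

lemma card_Int_le_upper:
  assumes C: "C \<in> maximal_chains r" and k: "Suc k < n" and X: "X \<subseteq> level k"
  shows "card (C \<inter> X) \<le> card (C \<inter> upper k X)"
proof (cases "C \<inter> X = {}")
  case False
  obtain x where x: "C \<inter> level k = {x}" using chain_Int_level C k by (meson Suc_lessD)
  then have "C \<inter> X \<subseteq> {x}" using X by blast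
  then have CX: "C \<inter> X = {x}" using False by (simp add: subset_singleton_iff)
  obtain y where y: "C \<inter> level (Suc k) = {y}" using chain_Int_level C k by blast
  have "(x, y) \<in> r"
  proof (rule ccontr)
    assume "(x, y) \<notin> r"
    then have "(y, x) \<in> r" "y \<noteq> x"
      using x y C[THEN maximal_chainD] refl_r level_subset by (auto simp: Chains_def)
    then have "card (below C y) < card (below C x)"
      using below_less C maximal_chainD y by blast
    moreover have "x \<in> C" "x \<in> level k" "y \<in> C" "y \<in> level (Suc k)" using x y by blast+
    ultimately show False using level_iff[OF C] by fastforce
  qed
  then have "{y} \<subseteq> C \<inter> upper k X" using y CX by (auto simp: upper_def)
  then have "card {y} \<le> card (C \<inter> upper k X)"
    using finite_upper by (intro card_mono) auto
  then show ?thesis using CX by simp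
qed simp

text \<open>Comparison with level 0 leaves the common degree unnamed and keeps all conditions
  homogeneous, so that they survive sums and division by a positive integer.\<close>

definition balanced :: "('a \<Rightarrow>\<^sub>0 nat) set" where
  "balanced = {f. Poly_Mapping.keys f \<subseteq> P \<and>
     (\<forall>k<n. sum (Poly_Mapping.lookup f) (level k) = sum (Poly_Mapping.lookup f) (level 0)) \<and>
     (\<forall>k X. Suc k < n \<longrightarrow> X \<subseteq> level k \<longrightarrow>
        sum (Poly_Mapping.lookup f) X \<le> sum (Poly_Mapping.lookup f) (upper k X))}"

lemma
  assumes "f \<in> balanced"
  shows balanced_keys: "Poly_Mapping.keys f \<subseteq> P"
    and balanced_level: "k < n \<Longrightarrow>
      sum (Poly_Mapping.lookup f) (level k) = sum (Poly_Mapping.lookup f) (level 0)"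
    and balanced_upper: "Suc k < n \<Longrightarrow> X \<subseteq> level k \<Longrightarrow>
      sum (Poly_Mapping.lookup f) X \<le> sum (Poly_Mapping.lookup f) (upper k X)"
proof -
  note f = assms[unfolded balanced_def mem_Collect_eq]
  show "Poly_Mapping.keys f \<subseteq> P" by (rule f[THEN conjunct1])
  show "sum (Poly_Mapping.lookup f) (level k) = sum (Poly_Mapping.lookup f) (level 0)" if "k < n"
    using that by (rule f[THEN conjunct2, THEN conjunct1, rule_format])
  show "sum (Poly_Mapping.lookup f) X \<le> sum (Poly_Mapping.lookup f) (upper k X)"
    if "Suc k < n" "X \<subseteq> level k"
    using that by (rule f[THEN conjunct2, THEN conjunct2, rule_format])
qed

lemma chain_monoid_subset_balanced: "chain_monoid r \<subseteq> balanced"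
  unfolding chain_monoid_def
proof (rule hull_minimal)
  show "add_closed balanced"
    unfolding add_closed_def
  proof (intro ballI)
    fix f g assume f: "f \<in> balanced" and g: "g \<in> balanced"
    have sum_add: "sum (Poly_Mapping.lookup (f + g)) X
        = sum (Poly_Mapping.lookup f) X + sum (Poly_Mapping.lookup g) X" for X
      by (simp add: lookup_add sum.distrib)
    show "f + g \<in> balanced"
      unfolding balanced_def
    proof (intro CollectI conjI allI impI)
      show "Poly_Mapping.keys (f + g) \<subseteq> P"
        using f[THEN balanced_keys] g[THEN balanced_keys] Poly_Mapping.keys_add[of f g] by blast
      show "sum (Poly_Mapping.lookup (f + g)) (level k) = sum (Poly_Mapping.lookup (f + g)) (level 0)"
        if "k < n" for k
        unfolding sum_add using f g that by (metis balanced_level)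
      show "sum (Poly_Mapping.lookup (f + g)) X \<le> sum (Poly_Mapping.lookup (f + g)) (upper k X)"
        if "Suc k < n" "X \<subseteq> level k" for k X
        unfolding sum_add using f g that by (intro add_mono balanced_upper)
    qed
  qed
  have "indicator_exponent C \<in> balanced" if C: "C \<in> maximal_chains r" for C
  proof -
    have fC: "finite C" "C \<subseteq> P" using C maximal_chainD finite_chain chain_subset by auto
    have one: "card (C \<inter> level k) = 1" if "k < n" for k
      by (rule chain_Int_level[OF C that]) simp
    show ?thesis
      unfolding balanced_def
    proof (intro CollectI conjI allI impI)
      fix k X assume kX: "Suc k < n" "X \<subseteq> level k"
      then have "finite X" using finite_level finite_subset by blast
      then show "sum (Poly_Mapping.lookup (indicator_exponent C)) X
          \<le> sum (Poly_Mapping.lookup (indicator_exponent C)) (upper k X)"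
        using card_Int_le_upper[OF C kX] fC(1)
        by (simp add: sum_lookup_indicator_exponent finite_upper)
    next
      show "Poly_Mapping.keys (indicator_exponent C) \<subseteq> P"
        using fC by (simp add: keys_indicator_exponent)
      have "sum (Poly_Mapping.lookup (indicator_exponent C)) (level k) = 1" if "k < n" for k
        using one[OF that] fC(1) by (simp only: sum_lookup_indicator_exponent finite_level)
      then show "sum (Poly_Mapping.lookup (indicator_exponent C)) (level k)
          = sum (Poly_Mapping.lookup (indicator_exponent C)) (level 0)" if "k < n" for k
        using that by (metis gr_zeroI not_less0)
    qed
  qed
  moreover have "0 \<in> balanced" by (simp add: balanced_def)
  ultimately show "insert 0 (indicator_exponent ` maximal_chains r) \<subseteq> balanced" by blast
qed

text \<open>Distinct levels are disjoint, so such a path has n elements, and by purity this makes a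
  chain maximal.\<close>

lemma level_path_maximal_chain:
  assumes c: "\<And>k. k < n \<Longrightarrow> c k \<in> level k"
    and step: "\<And>k. Suc k < n \<Longrightarrow> (c k, c (Suc k)) \<in> r"
  shows "c ` {..<n} \<in> maximal_chains r"
proof (rule maximal_chainI)
  have mono: "l < n \<longrightarrow> (c k, c l) \<in> r" if "k \<le> l" for k l
    using that
  proof (induction l rule: dec_induct)
    case base
    show ?case using c[of k] level_subset[of k] refl_r by blast
  next
    case (step l)
    show ?case
    proof
      assume "Suc l < n"
      then have "(c k, c l) \<in> r" "(c l, c (Suc l)) \<in> r" using step.IH assms(2) by simp_all
      then show "(c k, c (Suc l)) \<in> r" by (rule trans_r)
    qed
  qed
  show "c ` {..<n} \<in> Chains r"
    unfolding Chains_def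
  proof (rule CollectI, intro ballI)
    fix a b assume "a \<in> c ` {..<n}" "b \<in> c ` {..<n}"
    then show "(a, b) \<in> r \<or> (b, a) \<in> r" using mono by (metis imageE lessThan_iff nle_le)
  qed
  have "inj_on c {..<n}" using c level_disjoint by (metis inj_onI lessThan_iff)
  then show "card (c ` {..<n}) = n" by (simp add: card_image)
qed

text \<open>A balanced function of degree \<open>d\<close> on each level is written as a sum of \<open>d\<close> chains built level
  by level; the inequalities in the definition of balanced are Hall's condition for the next step.\<close>

lemma balanced_subset_chain_monoid: "balanced \<subseteq> chain_monoid r"
proof
  fix f assume f: "f \<in> balanced"
  define g where "g = Poly_Mapping.lookup f"
  define d where "d = sum g (level 0)"
  have level_sum: "sum g (level k) = d" if "k < n" for k
    unfolding g_def d_def using f that by (rule balanced_level)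
  \<comment> \<open>Here c records the positions of d strands in level k, with \<open>g x\<close> of
    them at x. The guard k < n makes the claim vacuous past the top, so that the dependent choice
    can run over all k.\<close>
  define good where "good k c \<longleftrightarrow> (k < n \<longrightarrow> (\<forall>j<d. c j \<in> level k) \<and>
    (\<forall>x\<in>level k. card {j \<in> {..<d}. c j = x} = g x))" for k and c :: "nat \<Rightarrow> 'a"
  define next_to where "next_to k c c' \<longleftrightarrow> (Suc k < n \<longrightarrow> (\<forall>j<d. (c j, c' j) \<in> r))"
    for k and c c' :: "nat \<Rightarrow> 'a"
  have "\<exists>c. good 0 c"
  proof -
    \<comment> \<open>In level 0 each strand may start anywhere, so Hall's condition reduces to
      \<open>card J <= d\<close>.\<close>
    have "card J \<le> sum g (\<Union>((\<lambda>_. level 0) ` J))" if "J \<subseteq> {..<d}" for J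
      using card_mono[OF _ that] by (cases "J = {}") (auto simp: d_def)
    then have "\<exists>c. (\<forall>j<d. c j \<in> level 0) \<and> (\<forall>x\<in>level 0. card {j \<in> {..<d}. c j = x} = g x)"
      by (intro hall_assignment) (auto simp: finite_level d_def)
    then show ?thesis by (auto simp: good_def)
  qed
  moreover have "\<exists>c'. good (Suc k) c' \<and> next_to k c c'" if c: "good k c" for k c
  proof (cases "Suc k < n")
    case True
    have cl: "c j \<in> level k" if "j < d" for j using c True that by (simp add: good_def)
    have cnt: "card {j \<in> {..<d}. c j = x} = g x" if "x \<in> level k" for x
      using c True that by (simp add: good_def)
    have "card J \<le> sum g (\<Union>((\<lambda>j. upper k {c j}) ` J))" if J: "J \<subseteq> {..<d}" for J
    proof -
      have cJ: "c ` J \<subseteq> level k" using cl J by auto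
      have fJ: "finite J" using J finite_subset by blast
      \<comment> \<open>The strands in J occupy elements whose total g-mass is at least
        \<open>card J\<close>; the inequality for \<open>upper\<close> passes this mass on to the
        next level.\<close>
      have "card J = (\<Sum>x\<in>c ` J. card {j \<in> J. c j = x})"
        using sum.group[of J "c ` J" c "\<lambda>_. 1::nat"] fJ by simp
      also have "\<dots> \<le> (\<Sum>x\<in>c ` J. card {j \<in> {..<d}. c j = x})"
        using J by (intro sum_mono card_mono) auto
      also have "\<dots> = sum g (c ` J)" using cJ by (intro sum.cong refl cnt) blast
      also have "\<dots> \<le> sum g (upper k (c ` J))"
        unfolding g_def using f True cJ by (rule balanced_upper)
      also have "upper k (c ` J) = \<Union>((\<lambda>j. upper k {c j}) ` J)" by (auto simp: upper_def)
      finally show ?thesis .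
    qed
    then have "\<exists>c'. (\<forall>j<d. c' j \<in> upper k {c j}) \<and>
        (\<forall>x\<in>level (Suc k). card {j \<in> {..<d}. c' j = x} = g x)"
      by (intro hall_assignment) (auto simp: finite_level level_sum True upper_def)
    then obtain c' where "\<forall>j<d. c' j \<in> upper k {c j}"
        "\<forall>x\<in>level (Suc k). card {j \<in> {..<d}. c' j = x} = g x" by blast
    then show ?thesis
      by (intro exI[of _ c']) (auto simp: good_def next_to_def upper_def)
  qed (auto simp: good_def next_to_def)
  ultimately obtain c where c: "\<And>k. good k (c k)" "\<And>k. next_to k (c k) (c (Suc k))"
    using dependent_nat_choice[of good next_to] by metis
  define path where "path j = (\<lambda>k. c k j) ` {..<n}" for j
  have path: "path j \<in> maximal_chains r" if "j < d" for j
    unfolding path_def using c that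
    by (intro level_path_maximal_chain) (auto simp: good_def next_to_def)
  have "f = (\<Sum>j<d. indicator_exponent (path j))"
  proof (rule poly_mapping_eqI)
    fix x
    have fin: "finite (path j)" for j by (simp add: path_def)
    have "Poly_Mapping.lookup (\<Sum>j<d. indicator_exponent (path j)) x
        = (\<Sum>j<d. if x \<in> path j then 1 else 0)"
      by (simp add: lookup_sum lookup_indicator_exponent fin)
    also have "\<dots> = card {j \<in> {..<d}. x \<in> path j}"
      by (simp add: sum.If_cases Int_def)
    also have "\<dots> = g x"
    proof (cases "x \<in> P")
      case True
      then obtain k where k: "k < n" "x \<in> level k" by (rule in_some_level)
      \<comment> \<open>Since levels are disjoint, x can only be the element of the path at position
        k.\<close>
      have "x \<in> path j \<longleftrightarrow> c k j = x" if "j < d" for j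
        using k that c(1) level_disjoint unfolding path_def good_def by blast
      then have "{j \<in> {..<d}. x \<in> path j} = {j \<in> {..<d}. c k j = x}" by blast
      then show ?thesis using c(1)[of k] k by (simp add: good_def)
    next
      case False
      then have "g x = 0" using balanced_keys[OF f] by (auto simp: g_def in_keys_iff)
      moreover have "x \<notin> path j" if "j < d" for j
        using path[OF that] maximal_chainD chain_subset False by blast
      ultimately show ?thesis by auto
    qed
    finally show "Poly_Mapping.lookup f x
        = Poly_Mapping.lookup (\<Sum>j<d. indicator_exponent (path j)) x"
      by (simp add: g_def)
  qed
  then show "f \<in> chain_monoid r"
    using path by (auto intro!: chain_monoid_sum indicator_in_chain_monoid)
qed

lemma chain_monoid_eq_balanced: "chain_monoid r = balanced"
  using chain_monoid_subset_balanced balanced_subset_chain_monoid by blast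

end

section \<open>Cancellation, saturation and division of balanced functions\<close>

text \<open>A fixed error cannot compensate a growing gap: p > q already fails at k = d + 1.\<close>

lemma nat_le_of_multiples_le:
  fixes p q :: nat
  assumes "\<And>k. c + k * p \<le> d + k * q" shows "p \<le> q"
proof (rule ccontr)
  assume "\<not> p \<le> q"
  then have "Suc d * Suc q \<le> Suc d * p" by (intro mult_le_mono2) simp
  then show False using assms[of "Suc d"] by simp
qed

context finite_pure_poset begin

text \<open>Support and level equations pass to a difference; inequalities do not, so they are left
  as a hypothesis.\<close>

lemma balanced_cancel:
  assumes "\<beta> \<in> balanced" "\<beta> + \<epsilon> \<in> balanced"
    and upper: "\<And>k X. Suc k < n \<Longrightarrow> X \<subseteq> level k \<Longrightarrow>
      sum (Poly_Mapping.lookup \<epsilon>) X \<le> sum (Poly_Mapping.lookup \<epsilon>) (upper k X)"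
  shows "\<epsilon> \<in> balanced"
  unfolding balanced_def
proof (intro CollectI conjI allI impI upper)
  have "Poly_Mapping.keys \<epsilon> \<subseteq> Poly_Mapping.keys (\<beta> + \<epsilon>)"
    by (auto simp: in_keys_iff lookup_add)
  then show "Poly_Mapping.keys \<epsilon> \<subseteq> P" using balanced_keys[OF assms(2)] by blast
  fix k assume "k < n"
  then show "sum (Poly_Mapping.lookup \<epsilon>) (level k) = sum (Poly_Mapping.lookup \<epsilon>) (level 0)"
    using balanced_level[OF assms(1), of k] balanced_level[OF assms(2), of k]
    by (simp add: lookup_add sum.distrib)
qed

text \<open>\<open>mult\<close> says, without subtraction, that \<gamma> + k (\<alpha> - \<beta>) is
  balanced for every k. As k grows, the fixed \<gamma> drops out of each linear inequality, which
  leaves it for \<alpha> - \<beta>.\<close>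

lemma balanced_saturated:
  assumes \<alpha>: "\<alpha> \<in> balanced" and \<beta>: "\<beta> \<in> balanced"
    and mult: "\<And>k. \<exists>\<delta>\<in>balanced. \<forall>x. Poly_Mapping.lookup \<gamma> x + k * Poly_Mapping.lookup \<alpha> x
      = Poly_Mapping.lookup \<delta> x + k * Poly_Mapping.lookup \<beta> x"
  shows "\<exists>\<epsilon>\<in>balanced. \<alpha> = \<beta> + \<epsilon>"
proof -
  have le: "Poly_Mapping.lookup \<beta> x \<le> Poly_Mapping.lookup \<alpha> x" for x
  proof (rule nat_le_of_multiples_le[of 0])
    fix k
    show "0 + k * Poly_Mapping.lookup \<beta> x \<le> Poly_Mapping.lookup \<gamma> x + k * Poly_Mapping.lookup \<alpha> x"
      using mult[of k] by auto
  qed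
  \<comment> \<open>Subtraction of naturals is truncated; \<open>le\<close> makes it exact
    here.\<close>
  define \<epsilon> where "\<epsilon> = \<alpha> - \<beta>"
  have eq: "\<alpha> = \<beta> + \<epsilon>"
    using le by (intro poly_mapping_eqI) (simp add: \<epsilon>_def lookup_add lookup_minus)
  have "sum (Poly_Mapping.lookup \<epsilon>) X \<le> sum (Poly_Mapping.lookup \<epsilon>) (upper l X)"
    if l: "Suc l < n" "X \<subseteq> level l" for l X
  proof (rule nat_le_of_multiples_le)
    fix k
    obtain \<delta> where \<delta>: "\<delta> \<in> balanced" "\<And>x. Poly_Mapping.lookup \<gamma> x + k * Poly_Mapping.lookup \<alpha> x
        = Poly_Mapping.lookup \<delta> x + k * Poly_Mapping.lookup \<beta> x"
      using mult[of k] by blast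
    have "Poly_Mapping.lookup \<delta> x = Poly_Mapping.lookup \<gamma> x + k * Poly_Mapping.lookup \<epsilon> x" for x
      using \<delta>(2)[of x] by (simp add: eq lookup_add algebra_simps)
    then have "sum (Poly_Mapping.lookup \<delta>) Y
        = sum (Poly_Mapping.lookup \<gamma>) Y + k * sum (Poly_Mapping.lookup \<epsilon>) Y" for Y
      by (simp add: sum.distrib sum_distrib_left)
    then show "sum (Poly_Mapping.lookup \<gamma>) X + k * sum (Poly_Mapping.lookup \<epsilon>) X
        \<le> sum (Poly_Mapping.lookup \<gamma>) (upper l X) + k * sum (Poly_Mapping.lookup \<epsilon>) (upper l X)"
      using balanced_upper[OF \<delta>(1) l] by simp
  qed
  then have "\<epsilon> \<in> balanced" using balanced_cancel[OF \<beta>] \<alpha> eq by simp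
  then show ?thesis using eq by blast
qed

text \<open>Here \<gamma> is m times \<alpha> - \<beta>, so its inequalities can be divided by
  m.\<close>

lemma balanced_divide:
  assumes \<alpha>: "\<alpha> \<in> balanced" and \<beta>: "\<beta> \<in> balanced" and \<gamma>: "\<gamma> \<in> balanced" and "m > 0"
    and eq: "\<And>x. m * Poly_Mapping.lookup \<alpha> x = m * Poly_Mapping.lookup \<beta> x + Poly_Mapping.lookup \<gamma> x"
  shows "\<exists>\<epsilon>\<in>balanced. \<forall>x. Poly_Mapping.lookup \<gamma> x = m * Poly_Mapping.lookup \<epsilon> x"
proof -
  define \<epsilon> where "\<epsilon> = \<alpha> - \<beta>"
  have "Poly_Mapping.lookup \<beta> x \<le> Poly_Mapping.lookup \<alpha> x" for x
    using eq[of x] \<open>m > 0\<close> by (metis le_add1 mult_le_cancel1)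
  then have sum_eq: "\<alpha> = \<beta> + \<epsilon>"
    by (intro poly_mapping_eqI) (simp add: \<epsilon>_def lookup_add lookup_minus)
  have \<gamma>\<epsilon>: "Poly_Mapping.lookup \<gamma> x = m * Poly_Mapping.lookup \<epsilon> x" for x
    using eq[of x] by (simp add: sum_eq lookup_add algebra_simps)
  have "sum (Poly_Mapping.lookup \<epsilon>) X \<le> sum (Poly_Mapping.lookup \<epsilon>) (upper l X)"
    if l: "Suc l < n" "X \<subseteq> level l" for l X
    using balanced_upper[OF \<gamma> l] \<open>m > 0\<close> by (simp add: \<gamma>\<epsilon> flip: sum_distrib_left)
  then have "\<epsilon> \<in> balanced" using balanced_cancel[OF \<beta>] \<alpha> sum_eq by simp
  then show ?thesis using \<gamma>\<epsilon> by blast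
qed

end

section \<open>Leading exponents and division\<close>

definition monoid_algebra :: "('a \<Rightarrow>\<^sub>0 nat) set \<Rightarrow> (('a \<Rightarrow>\<^sub>0 nat) \<Rightarrow>\<^sub>0 'k::field) set" where
  "monoid_algebra M = {p. Poly_Mapping.keys p \<subseteq> M}"

text \<open>Serves both for the chain monoid and for the ambient monoid of all exponents supported
  in P.\<close>

locale exponent_monoid =
  fixes M :: "('a \<Rightarrow>\<^sub>0 nat) set"
  assumes zero_mem: "0 \<in> M" and add_mem: "m \<in> M \<Longrightarrow> m' \<in> M \<Longrightarrow> m + m' \<in> M"
begin

lemma algebra_zero: "0 \<in> monoid_algebra M"
  by (simp add: monoid_algebra_def)

lemma algebra_one: "1 \<in> monoid_algebra M"
  using zero_mem by (simp add: monoid_algebra_def)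

lemma algebra_add: "p \<in> monoid_algebra M \<Longrightarrow> q \<in> monoid_algebra M \<Longrightarrow> p + q \<in> monoid_algebra M"
  using Poly_Mapping.keys_add[of p q] by (auto simp: monoid_algebra_def)

lemma algebra_uminus: "p \<in> monoid_algebra M \<Longrightarrow> - p \<in> monoid_algebra M"
  by (simp add: monoid_algebra_def)

lemma algebra_diff: "p \<in> monoid_algebra M \<Longrightarrow> q \<in> monoid_algebra M \<Longrightarrow> p - q \<in> monoid_algebra M"
  unfolding diff_conv_add_uminus by (intro algebra_add algebra_uminus)

lemma algebra_mult:
  assumes "p \<in> monoid_algebra M" "q \<in> monoid_algebra M"
  shows "p * q \<in> monoid_algebra M"
  unfolding monoid_algebra_def
proof (rule CollectI, rule subsetI)
  fix m assume "m \<in> Poly_Mapping.keys (p * q)"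
  then obtain a b where "m = a + b" "a \<in> Poly_Mapping.keys p" "b \<in> Poly_Mapping.keys q"
    using keys_mult[of p q] by blast
  then show "m \<in> M" using assms by (auto simp: monoid_algebra_def intro: add_mem)
qed

lemma algebra_power: "p \<in> monoid_algebra M \<Longrightarrow> p ^ k \<in> monoid_algebra M"
  by (induction k) (auto simp: algebra_one algebra_mult)

lemma algebra_sum: "(\<And>i. i \<in> I \<Longrightarrow> p i \<in> monoid_algebra M) \<Longrightarrow> sum p I \<in> monoid_algebra M"
  by (induction I rule: infinite_finite_induct) (auto simp: algebra_zero algebra_add)

lemma algebra_single: "m \<in> M \<Longrightarrow> Poly_Mapping.single m c \<in> monoid_algebra M"
  by (simp add: monoid_algebra_def)

end

text \<open>A multiplicative, injective weight makes the exponents supported in \<open>P\<close> a well-ordered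
  monoid, i.e. it is a monomial order. It exists by unique factorisation: send the variables to
  distinct primes.\<close>

locale exponent_weight =
  fixes P :: "'a set" and w :: "('a \<Rightarrow>\<^sub>0 nat) \<Rightarrow> nat"
  assumes w_add: "w (m + m') = w m * w m'" and w_pos: "w m > 0"
    and w_inj: "inj_on w {m. Poly_Mapping.keys m \<subseteq> P}"

lemma exponent_weight_exists:
  fixes P :: "'a set"
  assumes "finite P"
  shows "\<exists>w. exponent_weight P w"
proof -
  obtain h :: "'a \<Rightarrow> nat" where h: "inj_on h P"
    using finite_imp_inj_to_nat_seg[OF assms] by blast
  obtain g :: "nat \<Rightarrow> nat" where g: "inj g" "range g \<subseteq> {p. prime p}"
    using infinite_countable_subset[OF primes_infinite] by blast
  define e where "e x = g (h x)" for x
  have e: "inj_on e P" "prime (e x)" for x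
    using g h by (auto simp: e_def inj_on_def image_subset_iff)
  define w where "w m = (\<Prod>x\<in>P. e x ^ Poly_Mapping.lookup m x)" for m
  have mult: "multiplicity (e x) (w m) = Poly_Mapping.lookup m x" if "x \<in> P" for m x
  proof -
    \<comment> \<open>A product over the primes themselves is the form from which
      \<open>multiplicity_prod_prime_powers\<close> reads off exponents.\<close>
    have "w m = (\<Prod>p\<in>e ` P. p ^ Poly_Mapping.lookup m (inv_into P e p))"
      using e(1) by (simp add: prod.reindex w_def)
    then show ?thesis
      using e that assms by (simp only:) (subst multiplicity_prod_prime_powers, auto)
  qed
  have "exponent_weight P w"
  proof
    show "w (m + m') = w m * w m'" for m m'
      by (simp add: w_def lookup_add power_add prod.distrib)
    show "w m > 0" for m
      using e(2) by (simp add: w_def prime_gt_0_nat prod_pos)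
    show "inj_on w {m. Poly_Mapping.keys m \<subseteq> P}"
    proof (rule inj_onI, rule poly_mapping_eqI)
      fix m m' x
      assume m: "m \<in> {m. Poly_Mapping.keys m \<subseteq> P}" "m' \<in> {m. Poly_Mapping.keys m \<subseteq> P}" "w m = w m'"
      show "Poly_Mapping.lookup m x = Poly_Mapping.lookup m' x"
      proof (cases "x \<in> P")
        case True
        then show ?thesis using mult[of x m] mult[of x m'] m(3) by simp
      next
        case False
        then have "x \<notin> Poly_Mapping.keys m" "x \<notin> Poly_Mapping.keys m'" using m by auto
        then show ?thesis by (simp add: in_keys_iff)
      qed
    qed
  qed
  then show ?thesis by blast
qed

section \<open>Multiplicativity of leading terms\<close>

context exponent_weight
begin

abbreviation N :: "('a \<Rightarrow>\<^sub>0 nat) set" where "N \<equiv> {m. Poly_Mapping.keys m \<subseteq> P}"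

sublocale N: exponent_monoid N
proof unfold_locales
  fix m m' assume "m \<in> N" "m' \<in> N"
  then show "m + m' \<in> N" using Poly_Mapping.keys_add[of m m'] by auto
qed simp

text \<open>A maximum exists only for nonzero p; among exponents supported in P it is unique by
  \<open>w_inj\<close>, which is what \<open>lead_less\<close> records.\<close>

definition lead :: "(('a \<Rightarrow>\<^sub>0 nat) \<Rightarrow>\<^sub>0 'k::field) \<Rightarrow> ('a \<Rightarrow>\<^sub>0 nat)" where
  "lead p = (SOME m. m \<in> Poly_Mapping.keys p \<and> (\<forall>m'\<in>Poly_Mapping.keys p. w m' \<le> w m))"

lemma
  fixes p :: "('a \<Rightarrow>\<^sub>0 nat) \<Rightarrow>\<^sub>0 'k::field"
  assumes "p \<noteq> 0"
  shows lead_in_keys: "lead p \<in> Poly_Mapping.keys p"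
    and lead_max: "m \<in> Poly_Mapping.keys p \<Longrightarrow> w m \<le> w (lead p)"
proof -
  have ne: "w ` Poly_Mapping.keys p \<noteq> {}" using assms by (metis image_is_empty keys_eq_empty)
  then obtain m\<^sub>0 where "m\<^sub>0 \<in> Poly_Mapping.keys p" "w m\<^sub>0 = Max (w ` Poly_Mapping.keys p)"
    using Max_in[OF _ ne] by (metis finite_imageI finite_keys imageE)
  then have "\<exists>m. m \<in> Poly_Mapping.keys p \<and> (\<forall>m'\<in>Poly_Mapping.keys p. w m' \<le> w m)"
    by (intro exI[of _ m\<^sub>0]) simp
  then have "lead p \<in> Poly_Mapping.keys p \<and> (\<forall>m'\<in>Poly_Mapping.keys p. w m' \<le> w (lead p))"
    unfolding lead_def by (rule someI_ex)
  then show "lead p \<in> Poly_Mapping.keys p"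
    "m \<in> Poly_Mapping.keys p \<Longrightarrow> w m \<le> w (lead p)" by auto
qed

lemma lead_less:
  assumes "p \<noteq> 0" "p \<in> monoid_algebra N" "m \<in> Poly_Mapping.keys p" "m \<noteq> lead p"
  shows "w m < w (lead p)"
proof -
  have "m \<in> N" "lead p \<in> N" using assms lead_in_keys[of p] by (auto simp: monoid_algebra_def)
  then have "w m \<noteq> w (lead p)" using w_inj assms(4) by (meson inj_onD)
  then show ?thesis using lead_max[OF assms(1,3)] by simp
qed

lemma leadI:
  assumes "p \<in> monoid_algebra N" "m \<in> Poly_Mapping.keys p"
    and "\<And>m'. m' \<in> Poly_Mapping.keys p \<Longrightarrow> w m' \<le> w m"
  shows "lead p = m"
proof (rule ccontr)
  assume "lead p \<noteq> m"
  moreover have "p \<noteq> 0" using assms(2) by auto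
  ultimately have "w m < w (lead p)" using lead_less assms(1,2) by metis
  then show False using assms(3)[OF lead_in_keys[OF \<open>p \<noteq> 0\<close>]] by simp
qed

lemma lead_single: "c \<noteq> 0 \<Longrightarrow> m \<in> N \<Longrightarrow> lead (Poly_Mapping.single m c) = m"
  by (rule leadI) (simp_all add: monoid_algebra_def)

text \<open>With the leading terms s and t split off, p q = s t + s (q - t) + (p - s) q. Only s t
  reaches the exponent \<open>lead p + lead q\<close>: for the second summand cancel
  \<open>lead p\<close>, for the third compare weights.\<close>

lemma lookup_mult_lead:
  fixes p q :: "('a \<Rightarrow>\<^sub>0 nat) \<Rightarrow>\<^sub>0 'k::field"
  assumes p: "p \<noteq> 0" "p \<in> monoid_algebra N" and q: "q \<noteq> 0" "q \<in> monoid_algebra N"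
  shows "Poly_Mapping.lookup (p * q) (lead p + lead q)
    = Poly_Mapping.lookup p (lead p) * Poly_Mapping.lookup q (lead q)"
proof -
  define s where "s = Poly_Mapping.single (lead p) (Poly_Mapping.lookup p (lead p))"
  define t where "t = Poly_Mapping.single (lead q) (Poly_Mapping.lookup q (lead q))"
  have rest: "m \<in> Poly_Mapping.keys f \<and> m \<noteq> lead f"
    if "m \<in> Poly_Mapping.keys (f - Poly_Mapping.single (lead f) (Poly_Mapping.lookup f (lead f)))"
    for m and f :: "('a \<Rightarrow>\<^sub>0 nat) \<Rightarrow>\<^sub>0 'k"
    using that by (auto simp: in_keys_iff lookup_minus lookup_single when_def split: if_splits)
  have "lead p + lead q \<notin> Poly_Mapping.keys (s * (q - t))"
  proof
    assume "lead p + lead q \<in> Poly_Mapping.keys (s * (q - t))"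
    then obtain a b where ab: "lead p + lead q = a + b" "a \<in> Poly_Mapping.keys s"
        "b \<in> Poly_Mapping.keys (q - t)"
      using keys_mult[of s "q - t"] by blast
    then have "a = lead p" by (auto simp: s_def split: if_splits)
    then show False using ab rest[of b q] by (simp add: t_def)
  qed
  moreover have "lead p + lead q \<notin> Poly_Mapping.keys ((p - s) * q)"
  proof
    assume "lead p + lead q \<in> Poly_Mapping.keys ((p - s) * q)"
    then obtain a b where ab: "lead p + lead q = a + b" "a \<in> Poly_Mapping.keys (p - s)"
        "b \<in> Poly_Mapping.keys q"
      using keys_mult[of "p - s" q] by blast
    then have "w a < w (lead p)" using rest[of a p] lead_less[OF p] by (simp add: s_def)
    moreover have "w b \<le> w (lead q)" using ab(3) lead_max[OF q(1)] by blast
    ultimately have "w a * w b < w (lead p) * w (lead q)"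
      using w_pos by (intro mult_less_le_imp_less) auto
    moreover have "w a * w b = w (lead p) * w (lead q)" using ab(1) by (metis w_add)
    ultimately show False by simp
  qed
  moreover have "p * q = s * t + s * (q - t) + (p - s) * q" by (simp add: algebra_simps)
  ultimately have "Poly_Mapping.lookup (p * q) (lead p + lead q)
      = Poly_Mapping.lookup (s * t) (lead p + lead q)"
    by (simp add: lookup_add in_keys_iff)
  then show ?thesis by (simp add: s_def t_def mult_single)
qed

text \<open>The leading coefficients lie in a field, so their product is nonzero.
  \<open>mult_nonzero\<close> is also the reason why the algebra is a domain.\<close>

lemma
  fixes p q :: "('a \<Rightarrow>\<^sub>0 nat) \<Rightarrow>\<^sub>0 'k::field"
  assumes p: "p \<noteq> 0" "p \<in> monoid_algebra N" and q: "q \<noteq> 0" "q \<in> monoid_algebra N"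
  shows mult_nonzero: "p * q \<noteq> 0" and lead_mult: "lead (p * q) = lead p + lead q"
proof -
  have key: "lead p + lead q \<in> Poly_Mapping.keys (p * q)"
    using lookup_mult_lead[OF p q] lead_in_keys[OF p(1)] lead_in_keys[OF q(1)]
    by (simp add: in_keys_iff)
  then show "p * q \<noteq> 0" by auto
  show "lead (p * q) = lead p + lead q"
  proof (rule leadI[OF N.algebra_mult[OF p(2) q(2)] key])
    fix m assume "m \<in> Poly_Mapping.keys (p * q)"
    then obtain a b where "m = a + b" "a \<in> Poly_Mapping.keys p" "b \<in> Poly_Mapping.keys q"
      using keys_mult[of p q] by blast
    then show "w m \<le> w (lead p + lead q)"
      using lead_max[OF p(1)] lead_max[OF q(1)] by (simp add: w_add mult_le_mono)
  qed
qed

lemma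
  fixes p :: "('a \<Rightarrow>\<^sub>0 nat) \<Rightarrow>\<^sub>0 'k::field"
  assumes p: "p \<noteq> 0" "p \<in> monoid_algebra N"
  shows power_nonzero: "p ^ k \<noteq> 0"
    and lookup_lead_power: "Poly_Mapping.lookup (lead (p ^ k)) x = k * Poly_Mapping.lookup (lead p) x"
proof -
  have "p ^ k \<noteq> 0 \<and> Poly_Mapping.lookup (lead (p ^ k)) x = k * Poly_Mapping.lookup (lead p) x"
  proof (induction k)
    case 0
    have "lead (1 :: ('a \<Rightarrow>\<^sub>0 nat) \<Rightarrow>\<^sub>0 'k) = 0"
      using lead_single[of "1::'k" 0] by (simp add: single_one)
    then show ?case by simp
  next
    case (Suc k)
    then show ?case
      using mult_nonzero[OF p, of "p ^ k"] lead_mult[OF p, of "p ^ k"] N.algebra_power[OF p(2)]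
      by (simp add: lookup_add)
  qed
  then show "p ^ k \<noteq> 0" "Poly_Mapping.lookup (lead (p ^ k)) x = k * Poly_Mapping.lookup (lead p) x"
    by auto
qed

text \<open>Division with respect to the leading exponents: comparing the leading exponents of
  \<open>c a\<^sup>k = b\<^sup>k q\<close> for all \<open>k\<close> shows that the leading term of \<open>b\<close> divides that of \<open>a\<close> within the
  algebra, and the remainder satisfies the same hypothesis.\<close>

lemma almost_integral_imp_divides:
  fixes a b c :: "('a \<Rightarrow>\<^sub>0 nat) \<Rightarrow>\<^sub>0 'k::field"
  assumes M: "exponent_monoid M" "M \<subseteq> N"
    and saturated: "\<And>\<alpha> \<beta> \<gamma>. \<alpha> \<in> M \<Longrightarrow> \<beta> \<in> M \<Longrightarrow> \<gamma> \<in> M \<Longrightarrow>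
      (\<And>k. \<exists>\<delta>\<in>M. \<forall>x. Poly_Mapping.lookup \<gamma> x + k * Poly_Mapping.lookup \<alpha> x
        = Poly_Mapping.lookup \<delta> x + k * Poly_Mapping.lookup \<beta> x) \<Longrightarrow> \<exists>\<epsilon>\<in>M. \<alpha> = \<beta> + \<epsilon>"
    and b: "b \<in> monoid_algebra M" "b \<noteq> 0" and c: "c \<in> monoid_algebra M" "c \<noteq> 0"
    and "a \<in> monoid_algebra M" and "\<And>k. \<exists>q\<in>monoid_algebra M. c * a ^ k = b ^ k * q"
  shows "\<exists>d\<in>monoid_algebra M. a = b * d"
  using assms(8-)
\<comment> \<open>The zero polynomial gets 0, which is below every weight because weights are
  positive.\<close>
proof (induction "if a = 0 then 0 else w (lead a)" arbitrary: a rule: less_induct)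
  case less
  interpret M: exponent_monoid M by (fact M(1))
  have sub: "p \<in> monoid_algebra N" if "p \<in> monoid_algebra M" for p :: "('a \<Rightarrow>\<^sub>0 nat) \<Rightarrow>\<^sub>0 'k"
    using that M(2) by (auto simp: monoid_algebra_def)
  have lead_mem: "lead p \<in> M" if "p \<in> monoid_algebra M" "p \<noteq> 0" for p :: "('a \<Rightarrow>\<^sub>0 nat) \<Rightarrow>\<^sub>0 'k"
    using that lead_in_keys[of p] by (auto simp: monoid_algebra_def)
  show ?case
  proof (cases "a = 0")
    case True
    then show ?thesis using M.algebra_zero by (intro bexI[of _ 0]) auto
  next
    case False
    note a = False less.prems(1)
    have "\<exists>\<epsilon>\<in>M. lead a = lead b + \<epsilon>"
    proof (rule saturated[of "lead a" "lead b" "lead c"])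
      fix k
      obtain q where q: "q \<in> monoid_algebra M" "c * a ^ k = b ^ k * q"
        using less.prems(2) by blast
      have ak: "a ^ k \<noteq> 0" "a ^ k \<in> monoid_algebra M"
        and bk: "b ^ k \<noteq> 0" "b ^ k \<in> monoid_algebra M"
        using power_nonzero a b sub M.algebra_power by auto
      have "c * a ^ k \<noteq> 0" using mult_nonzero c ak sub by blast
      then have "q \<noteq> 0" using q(2) by auto
      have "lead c + lead (a ^ k) = lead (b ^ k) + lead q"
        using lead_mult[OF c(2) sub[OF c(1)] ak(1) sub[OF ak(2)]]
          lead_mult[OF bk(1) sub[OF bk(2)] \<open>q \<noteq> 0\<close> sub[OF q(1)]] q(2) by simp
      then have "Poly_Mapping.lookup (lead c) x + k * Poly_Mapping.lookup (lead a) x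
          = Poly_Mapping.lookup (lead q) x + k * Poly_Mapping.lookup (lead b) x" for x
        using lookup_lead_power[OF a(1) sub[OF a(2)], of k x]
          lookup_lead_power[OF b(2) sub[OF b(1)], of k x] by (metis add.commute lookup_add)
      then show "\<exists>\<delta>\<in>M. \<forall>x. Poly_Mapping.lookup (lead c) x + k * Poly_Mapping.lookup (lead a) x
          = Poly_Mapping.lookup \<delta> x + k * Poly_Mapping.lookup (lead b) x"
        using lead_mem[OF q(1) \<open>q \<noteq> 0\<close>] by blast
    qed (use a b c lead_mem in auto)
    then obtain \<epsilon> where \<epsilon>: "\<epsilon> \<in> M" "lead a = lead b + \<epsilon>" by blast
    \<comment> \<open>With this coefficient b d has the same leading term as a, so it cancels in a -
      b d.\<close>
    define u where "u = Poly_Mapping.lookup a (lead a) / Poly_Mapping.lookup b (lead b)"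
    define d where "d = Poly_Mapping.single \<epsilon> u"
    have coeffs: "Poly_Mapping.lookup a (lead a) \<noteq> 0" "Poly_Mapping.lookup b (lead b) \<noteq> 0"
      using lead_in_keys a(1) b(2) by (metis in_keys_iff)+
    then have u: "u \<noteq> 0" by (simp add: u_def)
    have "Poly_Mapping.keys d = {\<epsilon>}" using u by (simp add: d_def)
    then have "d \<noteq> 0" by auto
    moreover have "lead d = \<epsilon>" unfolding d_def using u \<epsilon>(1) M(2) by (intro lead_single) auto
    moreover have "d \<in> monoid_algebra M" unfolding d_def using \<epsilon>(1) by (rule M.algebra_single)
    ultimately have d: "d \<in> monoid_algebra M" "d \<noteq> 0" "lead d = \<epsilon>" by auto
    define a' where "a' = a - b * d"
    have a': "a' \<in> monoid_algebra M"
      using a(2) b(1) d(1) by (simp add: a'_def M.algebra_diff M.algebra_mult)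
    have lead_bd: "lead (b * d) = lead a"
      using lead_mult b d sub \<epsilon>(2) by metis
    have "Poly_Mapping.lookup (b * d) (lead a) = Poly_Mapping.lookup a (lead a)"
      using lookup_mult_lead[OF b(2) sub[OF b(1)] d(2) sub[OF d(1)]] coeffs
      by (simp add: d(3) \<epsilon>(2)[symmetric]) (simp add: d_def u_def)
    then have "Poly_Mapping.lookup a' (lead a) = 0" by (simp add: a'_def lookup_minus)
    then have not_key: "lead a \<notin> Poly_Mapping.keys a'" by (simp add: in_keys_iff)
    have "(if a' = 0 then 0 else w (lead a')) < (if a = 0 then 0 else w (lead a))"
    proof (cases "a' = 0")
      case False
      have key: "lead a' \<in> Poly_Mapping.keys a'" using lead_in_keys[OF False] .
      then have ne: "lead a' \<noteq> lead a" using not_key by metis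
      have "lead a' \<in> Poly_Mapping.keys a \<or> lead a' \<in> Poly_Mapping.keys (b * d)"
        using key by (auto simp: a'_def in_keys_iff lookup_minus)
      then have "w (lead a') < w (lead a)"
      proof
        assume "lead a' \<in> Poly_Mapping.keys a"
        then show ?thesis using lead_less[OF a(1) sub[OF a(2)]] ne by blast
      next
        assume "lead a' \<in> Poly_Mapping.keys (b * d)"
        moreover have "b * d \<noteq> 0" using mult_nonzero b d sub by blast
        ultimately show ?thesis
          using lead_less[of "b * d" "lead a'"] sub[OF M.algebra_mult[OF b(1) d(1)]] ne lead_bd
          by simp
      qed
      then show ?thesis using False a(1) by simp
    qed (use a(1) w_pos in simp)
    moreover note a'
    moreover have "\<exists>q\<in>monoid_algebra M. c * a' ^ k = b ^ k * q" for k
    proof -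
      \<comment> \<open>Expanding one factor a' = a - b d raises the exponent of a, so i has to vary
        in the induction on j; i = 0 is the case wanted.\<close>
      have "\<exists>q\<in>monoid_algebra M. c * a ^ i * a' ^ j = b ^ (i + j) * q" for i j
      proof (induction j arbitrary: i)
        case 0
        then show ?case using less.prems(2)[of i] by simp
      next
        case (Suc j)
        obtain q1 where q1: "q1 \<in> monoid_algebra M" "c * a ^ Suc i * a' ^ j = b ^ (Suc i + j) * q1"
          using Suc.IH by blast
        obtain q2 where q2: "q2 \<in> monoid_algebra M" "c * a ^ i * a' ^ j = b ^ (i + j) * q2"
          using Suc.IH by blast
        have "c * a ^ i * a' ^ Suc j = c * a ^ Suc i * a' ^ j - b * d * (c * a ^ i * a' ^ j)"
          by (simp add: a'_def algebra_simps)
        also have "\<dots> = b ^ (i + Suc j) * (q1 - d * q2)"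
          unfolding q1(2) q2(2) by (simp add: algebra_simps)
        finally show ?case
          using q1(1) q2(1) d(1) by (intro bexI[of _ "q1 - d * q2"])
            (auto simp: M.algebra_diff M.algebra_mult)
      qed
      from this[of 0 k] show ?thesis by simp
    qed
    ultimately obtain d' where "d' \<in> monoid_algebra M" "a' = b * d'"
      using less.hyps[of a'] by blast
    then have "a = b * (d + d')" "d + d' \<in> monoid_algebra M"
      using d(1) by (auto simp: a'_def algebra_simps M.algebra_add)
    then show ?thesis by blast
  qed
qed

end

section \<open>Integral closure of monoid algebras\<close>

text \<open>Multiplying the monic equation of a/b by b^n = b^i b^(n-i) clears all denominators. The
  resulting equation holds between images of elements of R, and the embedding is injective.\<close>

lemma (in domain) integral_fraction_equation:
  assumes ab: "a \<in> carrier R" "b \<in> carrier R - {\<zero>}"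
    and "integral_over (frac_field R) (frac_embed R ` carrier R) (fraction R a b)"
  shows "\<exists>n::nat. \<exists>c \<in> {..<n} \<rightarrow> carrier R.
    a [^] n \<oplus> (\<Oplus>i\<in>{..<n}. c i \<otimes> (a [^] i \<otimes> b [^] (n - i))) = \<zero>"
proof -
  let ?F = "frac_field R" and ?e = "frac_embed R"
  interpret F: cring ?F by (rule cring_frac_field)
  interpret ring_hom_cring R ?F ?e
    by (intro ring_hom_cring.intro ring_hom_cring_axioms.intro is_cring F.is_cring frac_embed_hom)
  let ?x = "fraction R a b"
  have x: "?x \<in> carrier ?F" using ab by (rule frac_in_carrier)
  have xb: "?x \<otimes>\<^bsub>?F\<^esub> ?e b = ?e a" using ab by (rule frac_eq_quotient)
  have pow: "?x [^]\<^bsub>?F\<^esub> i \<otimes>\<^bsub>?F\<^esub> ?e (b [^] i) = ?e (a [^] i)" for i :: nat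
    using ab x F.nat_pow_distrib[of ?x "?e b" i] by (simp add: xb)
  obtain n :: nat and c where c: "c \<in> {..<n} \<rightarrow> ?e ` carrier R"
    and eq: "?x [^]\<^bsub>?F\<^esub> n \<oplus>\<^bsub>?F\<^esub> (\<Oplus>\<^bsub>?F\<^esub>i\<in>{..<n}. c i \<otimes>\<^bsub>?F\<^esub> ?x [^]\<^bsub>?F\<^esub> i) = \<zero>\<^bsub>?F\<^esub>"
    using assms(3) unfolding integral_over_def by blast
  have "\<forall>i\<in>{..<n}. \<exists>d\<in>carrier R. c i = ?e d" using c by (auto simp: Pi_iff)
  then obtain d where d: "\<And>i. i < n \<Longrightarrow> d i \<in> carrier R" "\<And>i. i < n \<Longrightarrow> c i = ?e (d i)"
    by (metis lessThan_iff)
  have cF: "c i \<in> carrier ?F" if "i < n" for i using d that by simp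
  let ?y = "a [^] n \<oplus> (\<Oplus>i\<in>{..<n}. d i \<otimes> (a [^] i \<otimes> b [^] (n - i)))"
  have term_closed: "d i \<otimes> (a [^] i \<otimes> b [^] (n - i)) \<in> carrier R" if "i < n" for i
    using that d ab by simp
  have term_eq: "c i \<otimes>\<^bsub>?F\<^esub> ?x [^]\<^bsub>?F\<^esub> i \<otimes>\<^bsub>?F\<^esub> ?e (b [^] n)
      = ?e (d i \<otimes> (a [^] i \<otimes> b [^] (n - i)))" if i: "i < n" for i
  proof -
    have "b [^] n = b [^] i \<otimes> b [^] (n - i)"
      using ab i nat_pow_mult[of b i "n - i"] by simp
    then have "c i \<otimes>\<^bsub>?F\<^esub> ?x [^]\<^bsub>?F\<^esub> i \<otimes>\<^bsub>?F\<^esub> ?e (b [^] n)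
        = c i \<otimes>\<^bsub>?F\<^esub> ?x [^]\<^bsub>?F\<^esub> i \<otimes>\<^bsub>?F\<^esub> (?e (b [^] i) \<otimes>\<^bsub>?F\<^esub> ?e (b [^] (n - i)))"
      using ab by simp
    also have "\<dots> = c i \<otimes>\<^bsub>?F\<^esub> ((?x [^]\<^bsub>?F\<^esub> i \<otimes>\<^bsub>?F\<^esub> ?e (b [^] i)) \<otimes>\<^bsub>?F\<^esub> ?e (b [^] (n - i)))"
      using ab x cF[OF i] by (simp add: F.m_assoc del: hom_mult)
    also have "\<dots> = ?e (d i \<otimes> (a [^] i \<otimes> b [^] (n - i)))"
      unfolding pow d(2)[OF i] using ab d(1)[OF i] by simp
    finally show ?thesis .
  qed
  have "?e ?y = ?e (a [^] n) \<oplus>\<^bsub>?F\<^esub> (\<Oplus>\<^bsub>?F\<^esub>i\<in>{..<n}. ?e (d i \<otimes> (a [^] i \<otimes> b [^] (n - i))))"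
    using ab term_closed by (simp add: Pi_def comp_def del: hom_mult)
  also have "\<dots> = ?x [^]\<^bsub>?F\<^esub> n \<otimes>\<^bsub>?F\<^esub> ?e (b [^] n) \<oplus>\<^bsub>?F\<^esub>
      (\<Oplus>\<^bsub>?F\<^esub>i\<in>{..<n}. c i \<otimes>\<^bsub>?F\<^esub> ?x [^]\<^bsub>?F\<^esub> i \<otimes>\<^bsub>?F\<^esub> ?e (b [^] n))"
    unfolding pow using term_eq term_closed
    by (intro arg_cong2[where f = "(\<oplus>\<^bsub>?F\<^esub>)"] F.finsum_cong' refl) auto
  also have "\<dots> = (?x [^]\<^bsub>?F\<^esub> n \<oplus>\<^bsub>?F\<^esub> (\<Oplus>\<^bsub>?F\<^esub>i\<in>{..<n}. c i \<otimes>\<^bsub>?F\<^esub> ?x [^]\<^bsub>?F\<^esub> i)) \<otimes>\<^bsub>?F\<^esub> ?e (b [^] n)"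
  proof -
    have f: "(\<lambda>i. c i \<otimes>\<^bsub>?F\<^esub> ?x [^]\<^bsub>?F\<^esub> i) \<in> {..<n} \<rightarrow> carrier ?F"
      using cF x by simp
    have bn: "?e (b [^] n) \<in> carrier ?F" using ab by simp
    show ?thesis
      using F.finsum_ldistr[OF finite_lessThan bn f] F.finsum_closed[OF f] x bn
      by (simp add: F.l_distr)
  qed
  also have "\<dots> = ?e \<zero>" unfolding eq using ab by simp
  finally have "?e ?y = ?e \<zero>" .
  moreover have "?y \<in> carrier R"
    using ab term_closed by (intro a_closed nat_pow_closed finsum_closed) auto
  ultimately have "?y = \<zero>" using inj_on_frac_embed by (meson inj_onD zero_closed)
  moreover have "d \<in> {..<n} \<rightarrow> carrier R" using d(1) by simp
  ultimately show ?thesis by blast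
qed

text \<open>The factor b^(n-1) clears the denominators of the powers of a/b below n, and the
  equation expresses all higher powers by lower ones. A stands for the carrier, a subset of the
  polynomial type given by its closure properties.\<close>

lemma multiples_of_integral_equation:
  fixes a b :: "'r::comm_ring_1"
  assumes c: "a ^ n + (\<Sum>i<n. c i * (a ^ i * b ^ (n - i))) = 0" and "n > 0"
    and A: "\<And>i. i < n \<Longrightarrow> c i \<in> A" "a \<in> A" "b \<in> A"
    and A_one: "1 \<in> A" and A_mult: "\<And>x y. x \<in> A \<Longrightarrow> y \<in> A \<Longrightarrow> x * y \<in> A"
    and A_uminus: "\<And>x. x \<in> A \<Longrightarrow> - x \<in> A"
    and A_sum: "\<And>f. (\<And>i. i < n \<Longrightarrow> f i \<in> A) \<Longrightarrow> (\<Sum>i<n. f i) \<in> A"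
  shows "\<exists>q\<in>A. b ^ (n - 1) * a ^ k = b ^ k * q"
proof (induction k rule: less_induct)
  case (less k)
  have A_power: "x ^ i \<in> A" if "x \<in> A" for x i
    using that by (induction i) (auto simp: A_one A_mult)
  show ?case
  proof (cases "k < n")
    case True
    then have "b ^ (n - 1) = b ^ k * b ^ (n - 1 - k)" by (simp flip: power_add)
    then show ?thesis
      using A A_mult A_power by (intro bexI[of _ "b ^ (n - 1 - k) * a ^ k"]) (auto simp: mult.assoc)
  next
    case False
    define m where "m = k - n"
    have k: "k = m + n" using False by (simp add: m_def)
    \<comment> \<open>Since m + i < m + n = k, the induction hypothesis covers these
      exponents.\<close>
    have "\<forall>i\<in>{..<n}. \<exists>q\<in>A. b ^ (n - 1) * a ^ (m + i) = b ^ (m + i) * q"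
      using less.IH by (simp add: k)
    then obtain q where q: "\<And>i. i < n \<Longrightarrow> q i \<in> A"
        "\<And>i. i < n \<Longrightarrow> b ^ (n - 1) * a ^ (m + i) = b ^ (m + i) * q i"
      by (metis lessThan_iff)
    have "a ^ n = - (\<Sum>i<n. c i * (a ^ i * b ^ (n - i)))"
      using c by (simp add: eq_neg_iff_add_eq_0)
    then have "b ^ (n - 1) * a ^ k = - (\<Sum>i<n. b ^ (n - 1) * a ^ m * (c i * (a ^ i * b ^ (n - i))))"
      by (simp add: k power_add mult.assoc sum_distrib_left)
    also have "(\<Sum>i<n. b ^ (n - 1) * a ^ m * (c i * (a ^ i * b ^ (n - i))))
        = (\<Sum>i<n. b ^ k * (c i * q i))"
    proof (rule sum.cong)
      fix i assume "i \<in> {..<n}"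
      then have i: "i < n" by simp
      have "b ^ (n - 1) * a ^ m * (c i * (a ^ i * b ^ (n - i)))
          = c i * b ^ (n - i) * (b ^ (n - 1) * a ^ (m + i))"
        by (simp add: power_add ac_simps)
      also have "\<dots> = (b ^ (n - i) * b ^ (m + i)) * (c i * q i)"
        unfolding q(2)[OF i] by (simp add: ac_simps)
      also have "b ^ (n - i) * b ^ (m + i) = b ^ k" using i by (simp add: k add.commute flip: power_add)
      finally show "b ^ (n - 1) * a ^ m * (c i * (a ^ i * b ^ (n - i))) = b ^ k * (c i * q i)" .
    qed simp
    also have "- (\<Sum>i<n. b ^ k * (c i * q i)) = b ^ k * - (\<Sum>i<n. c i * q i)"
      by (simp add: sum_distrib_left)
    finally have "b ^ (n - 1) * a ^ k = b ^ k * - (\<Sum>i<n. c i * q i)" .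
    moreover have "- (\<Sum>i<n. c i * q i) \<in> A"
      by (intro A_uminus A_sum A_mult A(1) q(1))
    ultimately show ?thesis by blast
  qed
qed

lemma poly_ring_in_simps:
  "(\<otimes>\<^bsub>poly_ring_in P\<lparr>carrier := A\<rparr>\<^esub>) = (*)" "(\<oplus>\<^bsub>poly_ring_in P\<lparr>carrier := A\<rparr>\<^esub>) = (+)"
  "\<one>\<^bsub>poly_ring_in P\<lparr>carrier := A\<rparr>\<^esub> = 1" "\<zero>\<^bsub>poly_ring_in P\<lparr>carrier := A\<rparr>\<^esub> = 0"
  by (simp_all add: poly_ring_in_def)

lemma (in exponent_monoid) cring_monoid_algebra:
  "cring (poly_ring_in P\<lparr>carrier := monoid_algebra M :: (('a \<Rightarrow>\<^sub>0 nat) \<Rightarrow>\<^sub>0 'k::field) set\<rparr>)"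
proof -
  have inverse: "\<exists>q\<in>monoid_algebra M. p + q = 0"
    if "p \<in> monoid_algebra M" for p :: "('a \<Rightarrow>\<^sub>0 nat) \<Rightarrow>\<^sub>0 'k"
    using algebra_uminus[OF that] by (intro bexI[of _ "- p"]) simp_all
  show ?thesis
    by (intro cringI abelian_groupI comm_monoidI; unfold poly_ring_in_simps)
      (simp_all add: algebra_zero algebra_one algebra_add algebra_mult inverse algebra_simps)
qed

text \<open>\<open>saturated\<close> is the monoid form of complete integral closedness. The
  structure operations are translated into those of the polynomial type, where division applies with
  c = b^(n-1).\<close>

lemma (in exponent_weight) normal_domain_monoid_algebra:
  assumes M: "exponent_monoid M" "M \<subseteq> N"
    and saturated: "\<And>\<alpha> \<beta> \<gamma>. \<alpha> \<in> M \<Longrightarrow> \<beta> \<in> M \<Longrightarrow> \<gamma> \<in> M \<Longrightarrow>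
      (\<And>k. \<exists>\<delta>\<in>M. \<forall>x. Poly_Mapping.lookup \<gamma> x + k * Poly_Mapping.lookup \<alpha> x
        = Poly_Mapping.lookup \<delta> x + k * Poly_Mapping.lookup \<beta> x) \<Longrightarrow> \<exists>\<epsilon>\<in>M. \<alpha> = \<beta> + \<epsilon>"
  shows "normal_domain (poly_ring_in Q\<lparr>carrier := monoid_algebra M :: (('a \<Rightarrow>\<^sub>0 nat) \<Rightarrow>\<^sub>0 'k::field) set\<rparr>)"
proof -
  let ?R = "poly_ring_in Q\<lparr>carrier := monoid_algebra M :: (('a \<Rightarrow>\<^sub>0 nat) \<Rightarrow>\<^sub>0 'k) set\<rparr>"
  interpret M: exponent_monoid M by (fact M(1))
  interpret R: cring ?R by (rule M.cring_monoid_algebra)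
  have sub: "p \<in> monoid_algebra N" if "p \<in> monoid_algebra M" for p :: "('a \<Rightarrow>\<^sub>0 nat) \<Rightarrow>\<^sub>0 'k"
    using that M(2) by (auto simp: monoid_algebra_def)
  have "domain ?R"
  proof (intro domain.intro domain_axioms.intro R.is_cring; unfold poly_ring_in_simps)
    fix a b assume ab: "a * b = 0" "a \<in> carrier ?R" "b \<in> carrier ?R"
    show "a = 0 \<or> b = 0"
    proof (rule ccontr)
      assume "\<not> (a = 0 \<or> b = 0)"
      then show False using mult_nonzero[of a b] ab sub by simp
    qed
  qed simp
  then interpret R: domain ?R .
  have pow: "a [^]\<^bsub>?R\<^esub> k = a ^ k" for a and k :: nat
    by (induction k) (simp_all add: poly_ring_in_simps mult.commute)
  have fsum: "finsum ?R f I = sum f I" if "finite I" "f \<in> I \<rightarrow> monoid_algebra M" for f and I :: "nat set"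
    using that
  proof (induction I)
    case empty
    show ?case by (simp add: poly_ring_in_simps)
  next
    case (insert i I)
    then show ?case using R.finsum_insert[of I i f] by (simp add: poly_ring_in_simps)
  qed
  show ?thesis
    unfolding normal_domain_def
  proof (intro conjI ballI impI, fact \<open>domain ?R\<close>)
    fix x assume "x \<in> carrier (frac_field ?R)"
      and int: "integral_over (frac_field ?R) (frac_embed ?R ` carrier ?R) x"
    then obtain a b where ab: "a \<in> carrier ?R" "b \<in> carrier ?R" "b \<noteq> \<zero>\<^bsub>?R\<^esub>" and x: "x = fraction ?R a b"
      by (auto elim: R.frac_fieldE)
    have a: "a \<in> monoid_algebra M" and b: "b \<in> monoid_algebra M" "b \<noteq> 0"
      using ab by (auto simp: poly_ring_in_simps)
    obtain n c where c: "c \<in> {..<n} \<rightarrow> carrier ?R" and eq: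
      "a [^]\<^bsub>?R\<^esub> n \<oplus>\<^bsub>?R\<^esub> (\<Oplus>\<^bsub>?R\<^esub>i\<in>{..<n::nat}. c i \<otimes>\<^bsub>?R\<^esub> (a [^]\<^bsub>?R\<^esub> i \<otimes>\<^bsub>?R\<^esub> b [^]\<^bsub>?R\<^esub> (n - i))) = \<zero>\<^bsub>?R\<^esub>"
      using R.integral_fraction_equation[OF ab(1) _ int[unfolded x]] ab by blast
    have cM: "c i \<in> monoid_algebra M" if "i < n" for i using c that by auto
    have eq': "a ^ n + (\<Sum>i<n. c i * (a ^ i * b ^ (n - i))) = 0"
      using eq unfolding pow poly_ring_in_simps
      by (subst (asm) fsum) (auto intro!: M.algebra_mult M.algebra_power a b cM)
    \<comment> \<open>For n = 0 the equation would read 1 = 0.\<close>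
    have "n > 0"
    proof (rule ccontr)
      assume "\<not> n > 0"
      then show False using eq' by simp
    qed
    have mult: "\<exists>q\<in>monoid_algebra M. b ^ (n - 1) * a ^ k = b ^ k * q" for k
      by (rule multiples_of_integral_equation[OF eq' \<open>n > 0\<close>])
        (auto intro: a b cM M.algebra_one M.algebra_mult M.algebra_uminus M.algebra_sum)
    have "\<exists>d\<in>monoid_algebra M. a = b * d"
    proof (rule almost_integral_imp_divides[OF M _ b _ _ a mult])
      show "b ^ (n - 1) \<in> monoid_algebra M" using b(1) by (rule M.algebra_power)
      show "b ^ (n - 1) \<noteq> 0" using b(2) sub[OF b(1)] by (rule power_nonzero)
    qed (rule saturated)
    then obtain d where d: "d \<in> monoid_algebra M" "a = b * d" by blast
    have "x = frac_embed ?R d"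
      unfolding x frac_embed_def using ab d
      by (subst R.frac_eq_iff) (auto simp: poly_ring_in_simps M.algebra_one mult.commute)
    then show "x \<in> frac_embed ?R ` carrier ?R" using d by simp
  qed
qed

section \<open>The chain algebra and the chain semigroup\<close>

text \<open>Carries the finite generating set of the chain monoid along
  \<open>int_exponents\<close>.\<close>

lemma hull_image_additive:
  assumes h: "\<And>x y. h (x + y) = h x + h y"
  shows "h ` (add_closed hull S) = add_closed hull (h ` S)"
proof
  have "h x \<in> add_closed hull (h ` S)" if "x \<in> add_closed hull S" for x
    using that
  proof (rule hull_induct)
    show "h x \<in> add_closed hull (h ` S)" if "x \<in> S" for x using that by (simp add: hull_inc)
    show "add_closed {x. h x \<in> add_closed hull (h ` S)}"
      using add_closed_hull[of "h ` S"] by (simp add: add_closed_def h)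
  qed
  then show "h ` (add_closed hull S) \<subseteq> add_closed hull (h ` S)" by blast
  show "add_closed hull (h ` S) \<subseteq> h ` (add_closed hull S)"
  proof (rule hull_minimal)
    show "h ` S \<subseteq> h ` (add_closed hull S)" by (intro image_mono hull_subset)
    have "h x + h y \<in> h ` (add_closed hull S)"
      if "x \<in> add_closed hull S" "y \<in> add_closed hull S" for x y
      using that add_closed_hull[of S] unfolding add_closed_def h[symmetric] by blast
    then show "add_closed (h ` (add_closed hull S))" by (auto simp: add_closed_def)
  qed
qed

lemma int_exponents_add: "int_exponents (f + g) = int_exponents f + int_exponents g"
  by (rule poly_mapping_eqI) (simp add: lookup_int_exponents lookup_add)

lemma prod_single:
  "(\<Prod>x\<in>A. Poly_Mapping.single (f x) (1::'k::comm_semiring_1)) = Poly_Mapping.single (sum f A) 1"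
  by (induction A rule: infinite_finite_induct) (simp_all add: mult_single single_one)

lemma var_poly_power:
  "var_poly x ^ k = (Poly_Mapping.single (Poly_Mapping.single x k) 1 :: ('a \<Rightarrow>\<^sub>0 nat) \<Rightarrow>\<^sub>0 'k::field)"
  by (induction k) (simp_all add: var_poly_def mult_single single_one flip: single_add)

lemma chain_monomial_eq:
  "chain_monomial C = (Poly_Mapping.single (indicator_exponent C) 1 :: ('a \<Rightarrow>\<^sub>0 nat) \<Rightarrow>\<^sub>0 'k::field)"
  by (simp add: chain_monomial_def var_poly_def prod_single indicator_exponent_def)

text \<open>Used on two levels: for an exponent as a sum over variables, and for a polynomial as a
  sum of terms.\<close>

lemma sum_single_lookup:
  assumes "finite A" "Poly_Mapping.keys p \<subseteq> A"
  shows "(\<Sum>m\<in>A. Poly_Mapping.single m (Poly_Mapping.lookup p m)) = p"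
proof (rule poly_mapping_eqI)
  fix m
  have "m \<notin> A \<Longrightarrow> Poly_Mapping.lookup p m = 0" using assms(2) by (auto simp: in_keys_iff)
  then show "Poly_Mapping.lookup (\<Sum>m\<in>A. Poly_Mapping.single m (Poly_Mapping.lookup p m)) m
      = Poly_Mapping.lookup p m"
    using assms(1) by (simp add: lookup_sum lookup_single when_def)
qed

lemma exponent_monoid_chain_monoid: "exponent_monoid (chain_monoid r)"
  by (intro exponent_monoid.intro zero_in_chain_monoid chain_monoid_add)

context finite_pure_poset
begin

lemma chain_monoid_keys: "f \<in> chain_monoid r \<Longrightarrow> Poly_Mapping.keys f \<subseteq> P"
  using balanced_keys chain_monoid_eq_balanced by blast

text \<open>All generators are single terms, and products of terms are terms whose exponents add up;
  so the generated ring consists of the sums of terms with exponents in the monoid.\<close>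

lemma chain_algebra_eq:
  "chain_algebra P r = poly_ring_in P
     \<lparr>carrier := monoid_algebra (chain_monoid r) :: (('a \<Rightarrow>\<^sub>0 nat) \<Rightarrow>\<^sub>0 'k::field) set\<rparr>"
proof -
  let ?R = "poly_ring_in P :: (('a \<Rightarrow>\<^sub>0 nat) \<Rightarrow>\<^sub>0 'k) ring"
  let ?H = "range const_poly \<union> chain_monomial ` maximal_chains r :: (('a \<Rightarrow>\<^sub>0 nat) \<Rightarrow>\<^sub>0 'k) set"
  let ?A = "monoid_algebra (chain_monoid r) :: (('a \<Rightarrow>\<^sub>0 nat) \<Rightarrow>\<^sub>0 'k) set"
  interpret M: exponent_monoid "chain_monoid r" by (rule exponent_monoid_chain_monoid)
  interpret R: cring ?R by (rule cring_poly_ring_in)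
  have ops: "(\<otimes>\<^bsub>?R\<^esub>) = (*)" "(\<oplus>\<^bsub>?R\<^esub>) = (+)" "\<one>\<^bsub>?R\<^esub> = 1" "\<zero>\<^bsub>?R\<^esub> = 0"
    by (simp_all add: poly_ring_in_def)
  have carrier: "?A \<subseteq> carrier ?R"
    using chain_monoid_keys by (auto simp: monoid_algebra_def poly_ring_in_def)
  have "p \<in> ?A" if "p \<in> generate_ring ?R ?H" for p
    using that
  proof induction
    case (incl h)
    then show ?case
      by (auto simp: const_poly_def chain_monomial_eq
          intro!: M.algebra_single zero_in_chain_monoid indicator_in_chain_monoid)
  next
    case (a_inv h)
    then have "\<ominus>\<^bsub>?R\<^esub> h = - h"
      using carrier M.algebra_uminus[OF a_inv.IH] by (intro R.minus_equality) (auto simp: ops)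
    then show ?case using M.algebra_uminus[OF a_inv.IH] by simp
  qed (simp_all add: ops M.algebra_one M.algebra_add M.algebra_mult)
  moreover have "p \<in> generate_ring ?R ?H" if p: "p \<in> ?A" for p
  proof -
    have mult: "x * y \<in> generate_ring ?R ?H"
      if "x \<in> generate_ring ?R ?H" "y \<in> generate_ring ?R ?H" for x y
      using generate_ring.eng_mult[OF that] by (simp add: ops)
    have add: "x + y \<in> generate_ring ?R ?H"
      if "x \<in> generate_ring ?R ?H" "y \<in> generate_ring ?R ?H" for x y
      using generate_ring.eng_add[OF that] by (simp add: ops)
    have const: "Poly_Mapping.single 0 c \<in> generate_ring ?R ?H" for c :: 'k
      by (rule generate_ring.incl) (simp flip: const_poly_def)
    have mono: "Poly_Mapping.single m 1 \<in> generate_ring ?R ?H" if "m \<in> chain_monoid r" for m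
      using that unfolding chain_monoid_def
    proof (rule hull_induct)
      fix m assume "m \<in> insert 0 (indicator_exponent ` maximal_chains r)"
      then consider "m = 0" | C where "C \<in> maximal_chains r" "m = indicator_exponent C" by blast
      then show "Poly_Mapping.single m 1 \<in> generate_ring ?R ?H"
      proof cases
        case 2
        then show ?thesis by (intro generate_ring.incl) (auto simp flip: chain_monomial_eq)
      qed (simp only: const)
    next
      show "add_closed {m. Poly_Mapping.single m 1 \<in> generate_ring ?R ?H}"
        unfolding add_closed_def
      proof (intro ballI, rule CollectI)
        fix m m' assume "m \<in> {m. Poly_Mapping.single m 1 \<in> generate_ring ?R ?H}"
          "m' \<in> {m. Poly_Mapping.single m 1 \<in> generate_ring ?R ?H}"
        then show "Poly_Mapping.single (m + m') 1 \<in> generate_ring ?R ?H"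
          using mult[of "Poly_Mapping.single m 1" "Poly_Mapping.single m' 1"]
          by (simp add: mult_single)
      qed
    qed
    have "Poly_Mapping.single m c \<in> generate_ring ?R ?H" if "m \<in> chain_monoid r" for m c
      using mult[OF const[of c] mono[OF that]] by (simp add: mult_single)
    moreover have "0 \<in> generate_ring ?R ?H" using const[of 0] by simp
    ultimately have sum: "(\<Sum>m\<in>I. Poly_Mapping.single m (Poly_Mapping.lookup p m)) \<in> generate_ring ?R ?H"
      if "I \<subseteq> chain_monoid r" for I
      using that by (induction I rule: infinite_finite_induct) (auto intro: add)
    have "Poly_Mapping.keys p \<subseteq> chain_monoid r" using p by (simp add: monoid_algebra_def)
    from sum[OF this] show ?thesis by (simp only: sum_single_lookup finite_keys order_refl)
  qed
  ultimately have "generate_ring ?R ?H = ?A" by blast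
  then show ?thesis by (simp add: chain_algebra_def)
qed

text \<open>The monomial of f has coefficient 1, which is nonzero in every field, so its membership
  in the algebra is decided by f alone.\<close>

lemma chain_semigroup_eq: "chain_semigroup TYPE('k::field) P r = chain_monoid r"
proof -
  have "(\<Prod>x\<in>P. var_poly x ^ Poly_Mapping.lookup f x)
      = (Poly_Mapping.single f 1 :: ('a \<Rightarrow>\<^sub>0 nat) \<Rightarrow>\<^sub>0 'k)" if "Poly_Mapping.keys f \<subseteq> P" for f
    using that finite_P by (simp add: var_poly_power prod_single sum_single_lookup)
  then show ?thesis
    using chain_monoid_keys
    by (auto simp: chain_semigroup_def chain_algebra_eq monoid_algebra_def)
qed

section \<open>Normality of the chain semigroup and of the chain algebra\<close>

lemma affine_semigroup_chain_monoid: "affine_semigroup (int_exponents ` chain_monoid r)"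
  unfolding affine_semigroup_def
proof (intro conjI)
  \<comment> \<open>\<open>undefined\<close> keeps the index set nonempty when P is empty.\<close>
  have "Poly_Mapping.keys (int_exponents f) \<subseteq> insert undefined P" if "f \<in> chain_monoid r" for f
  proof -
    have "Poly_Mapping.keys (int_exponents f) = Poly_Mapping.keys f"
      by (auto simp: in_keys_iff lookup_int_exponents)
    then show ?thesis using chain_monoid_keys[OF that] by blast
  qed
  then show "\<exists>I. finite I \<and> I \<noteq> {} \<and> (\<forall>\<alpha>\<in>int_exponents ` chain_monoid r. Poly_Mapping.keys \<alpha> \<subseteq> I)"
    using finite_P by (intro exI[of _ "insert undefined P"]) auto
  have "int_exponents ` chain_monoid r
      = add_closed hull (int_exponents ` insert 0 (indicator_exponent ` maximal_chains r))"
    unfolding chain_monoid_def by (rule hull_image_additive) (rule int_exponents_add)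
  moreover have "finite (int_exponents ` insert 0 (indicator_exponent ` maximal_chains r))"
    by (intro finite_imageI finite_insert[THEN iffD2] finite_maximal_chains)
  ultimately show "\<exists>G. finite G \<and> int_exponents ` chain_monoid r = add_closed hull G"
    by (intro exI conjI)
  have "int_exponents 0 = 0"
    by (rule poly_mapping_eqI) (simp add: lookup_int_exponents)
  then show "0 \<in> int_exponents ` chain_monoid r" using zero_in_chain_monoid by (metis imageI)
qed

text \<open>All members come from natural exponents and the multiplier is positive, so the integer
  equation is one between naturals, to which \<open>balanced_divide\<close> applies.\<close>

lemma normal_affine_semigroup_chain_monoid:
  "normal_affine_semigroup (int_exponents ` chain_monoid r)"
  unfolding normal_affine_semigroup_def
proof (intro conjI ballI allI impI affine_semigroup_chain_monoid)
  fix \<alpha> i assume "\<alpha> \<in> int_exponents ` chain_monoid r"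
  then show "0 \<le> Poly_Mapping.lookup \<alpha> i" by (auto simp: lookup_int_exponents)
next
  fix \<alpha> \<beta> \<gamma> and m :: int
  assume "\<alpha> \<in> int_exponents ` chain_monoid r" "\<beta> \<in> int_exponents ` chain_monoid r"
    "\<gamma> \<in> int_exponents ` chain_monoid r" and m: "0 < m"
    and eq: "frag_cmul m \<alpha> = frag_cmul m \<beta> + \<gamma>"
  then obtain f g h where fgh: "f \<in> balanced" "g \<in> balanced" "h \<in> balanced"
    and ints: "\<alpha> = int_exponents f" "\<beta> = int_exponents g" "\<gamma> = int_exponents h"
    by (auto simp: chain_monoid_eq_balanced)
  obtain k :: nat where k: "m = int k" "k > 0" using m by (metis pos_int_cases)
  have "k * Poly_Mapping.lookup f x = k * Poly_Mapping.lookup g x + Poly_Mapping.lookup h x" for x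
  proof -
    have "int (k * Poly_Mapping.lookup f x)
        = int (k * Poly_Mapping.lookup g x + Poly_Mapping.lookup h x)"
      using arg_cong[OF eq, of "\<lambda>p. Poly_Mapping.lookup p x"]
      by (simp add: ints k lookup_add lookup_int_exponents)
    then show ?thesis by (simp only: of_nat_eq_iff)
  qed
  then obtain e where e: "e \<in> balanced" "\<And>x. Poly_Mapping.lookup h x = k * Poly_Mapping.lookup e x"
    using balanced_divide[OF fgh k(2)] by blast
  have "\<gamma> = frag_cmul m (int_exponents e)"
    by (rule poly_mapping_eqI) (simp add: ints k e(2) lookup_int_exponents)
  then show "\<exists>\<gamma>'\<in>int_exponents ` chain_monoid r. \<gamma> = frag_cmul m \<gamma>'"
    using e(1) by (auto simp: chain_monoid_eq_balanced)
qed

lemma normal_domain_chain_algebra: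
  "normal_domain (chain_algebra P r :: (('a \<Rightarrow>\<^sub>0 nat) \<Rightarrow>\<^sub>0 'k::field) ring)"
proof -
  obtain w where "exponent_weight P w" using exponent_weight_exists[OF finite_P] by blast
  then interpret exponent_weight P w .
  show ?thesis
    unfolding chain_algebra_eq
  proof (rule normal_domain_monoid_algebra[OF exponent_monoid_chain_monoid])
    show "chain_monoid r \<subseteq> N" using chain_monoid_keys by blast
  qed (unfold chain_monoid_eq_balanced, rule balanced_saturated)
qed

end

theorem corollary3p3:
  fixes P :: "'a set" and r :: "'a rel"
  assumes "finite P" and "partial_order_on P r" and "pure_poset r"
  shows "normal_affine_semigroup (int_exponents ` chain_semigroup TYPE('k::field) P r) \<and>
         normal_domain (chain_algebra P r :: (('a \<Rightarrow>\<^sub>0 nat) \<Rightarrow>\<^sub>0 'k) ring)"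
proof -
  obtain \<rho> where \<rho>: "\<And>C. C \<in> maximal_chains r \<Longrightarrow> chain_length C = \<rho>"
    using assms(3) by (auto simp: pure_poset_def pure_of_rank_def)
  \<comment> \<open>The length is one less than the number of elements; the length -1 of the empty
    chain becomes 0.\<close>
  interpret finite_pure_poset P r "nat (\<rho> + 1)"
  proof
    fix C assume "C \<in> maximal_chains r"
    from \<rho>[OF this] show "card C = nat (\<rho> + 1)" by (simp add: chain_length_def)
  qed (use assms in auto)
  show ?thesis
    using normal_affine_semigroup_chain_monoid normal_domain_chain_algebra
    by (simp add: chain_semigroup_eq)
qed

end
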